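(* Let $n\ge2$ and let $\underline\zeta=(\zeta_1,\dots,\zeta_n)\in\mathbb R^n$ be such that $1,\zeta_1,\dots,\zeta_n$ are linearly independent over $\mathbb Q$. (i) Unconditionally, $$w_{n,3}(\underline\zeta)\ge\frac{\widehat w_n(\underline\zeta)^2}{w_n(\underline\zeta)}.$$ (ii) Suppose that there are infinitely many $k$ such that the $n+1$ consecutive best approximations $v_k,v_{k+1},\dots,v_{k+n}$ for the linear form are linearly independent. Then $$w_{n,i}(\underline\zeta)\ge\frac{\widehat w_n(\underline\zeta)^{i-1}}{w_n(\underline\zeta)^{i-2}}\quad(1\le i\le n+1)$$ and $$w_n(\underline\zeta)\ge\widehat w_n(\underline\zeta)\left(\frac{\widehat w_n(\underline\zeta)-1}{n-1}\right)^{\frac1{n-1}}.$$ (iii) Dually and unconditionally, $$\lambda_{n,3}(\underline\zeta)\ge\frac{\widehat\lambda_n(\underline\zeta)^2}{\lambda_n(\underline\zeta)}.$$ (iv) If there are infinitely many $k$ such that $n+1$ consecutive simultaneous best approximations $u_k,\dots,u_{k+n}$ are linearly independent, then $$\lambda_{n,i}(\underline\zeta)\ge\frac{\widehat\lambda_n(\underline\zeta)^{i-1}}{\lambda_n(\underline\zeta)^{i-2}}\quad(1\le i\le n+1)$$ and $$\lambda_n(\underline\zeta)\ge\widehat\lambda_n(\underline\zeta)\left(\frac{(n-1)\widehat\lambda_n(\underline\zeta)}{1-\widehat\lambda_n(\underline\zeta)}\right)^{\frac1{n-1}}.$$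
   Context: For an integer vector $v=(x,y_1,\dots,y_n)\in\mathbb Z^{n+1}$ let $H(v)=\max\{|x|,|y_1|,\dots,|y_n|\}$. Linear form exponents. Let $L(v)=x+\zeta_1y_1+\dots+\zeta_ny_n$. For $1\le j\le n+1$: - $w_{n,j}(\underline\zeta)$ is the supremum of $\nu$ such that, for arbitrarily large $X$, the system $H(v)\le X$, $|L(v)|\le X^{-\nu}$ has $j$ linearly independent integer solutions $v$; - $\widehat w_{n,j}(\underline\zeta)$ is the same supremum with "for all sufficiently large $X$" in place of "for arbitrarily large $X$"; - $w_n=w_{n,1}$ and $\widehat w_n=\widehat w_{n,1}$. Simultaneous approximation exponents. For $1\le j\le n+1$: - $\lambda_{n,j}(\underline\zeta)$ is the supremum of $\nu$ such that, for arbitrarily large $X$, the system $|x|\le X$, $\max_i|\zeta_ix-y_i|\le X^{-\nu}$ has $j$ linearly independent integer solutions $(x,y_1,\dots,y_n)$; - $\widehat\lambda_{n,j}$ is the same supremum with "for all large $X$"; - $\lambda_n=\lambda_{n,1}$ and $\widehat\lambda_n=\widehat\lambda_{n,1}$. Best approximations. A best approximation for the linear form is a nonzero $v\in\mathbb Z^{n+1}$ such that every nonzero $u\in\mathbb Z^{n+1}$ with $H(u)<H(v)$ satisfies $|L(u)|>|L(v)|$. Up to sign, these form a sequence $v_1,v_2,\dots$ with nondecreasing heights and strictly decreasing $|L(v_k)|$. Simultaneous best approximations $u_1,u_2,\dots$ are defined analogously, using $|x|$ in place of $H$ and $\max_i|\zeta_ix-y_i|$ in place of $|L|$. *)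

theory Defs
  imports "HOL-Analysis.Analysis"
begin

text \<open>Conventions. The dimension n is a natural number; zeta :: nat => real with zeta i
  for 1 <= i <= n the coordinates of the point. An integer vector (x, y_1, ..., y_n) of
  Z^(n+1) is a function v :: nat => int with v 0 = x, v i = y_i (1 <= i <= n), and
  v i = 0 for i > n.\<close>

definition int_vec :: "nat \<Rightarrow> (nat \<Rightarrow> int) \<Rightarrow> bool" where
  "int_vec n v \<longleftrightarrow> (\<forall>i>n. v i = 0)"

definition nonzero_vec :: "nat \<Rightarrow> (nat \<Rightarrow> int) \<Rightarrow> bool" where
  "nonzero_vec n v \<longleftrightarrow> (\<exists>i\<le>n. v i \<noteq> 0)"

text \<open>Linear independence of the j vectors V 0, ..., V (j-1) in Z^(n+1) (over R,
  equivalently over Q).\<close>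
definition lin_indep :: "nat \<Rightarrow> nat \<Rightarrow> (nat \<Rightarrow> nat \<Rightarrow> int) \<Rightarrow> bool" where
  "lin_indep n j V \<longleftrightarrow>
     (\<forall>c :: nat \<Rightarrow> real. (\<forall>i\<le>n. (\<Sum>k<j. c k * of_int (V k i)) = 0) \<longrightarrow> (\<forall>k<j. c k = 0))"

definition Q_lin_indep_1 :: "nat \<Rightarrow> (nat \<Rightarrow> real) \<Rightarrow> bool" where
  "Q_lin_indep_1 n \<zeta> \<longleftrightarrow>
     (\<forall>c :: nat \<Rightarrow> rat. of_rat (c 0) + (\<Sum>i=1..n. of_rat (c i) * \<zeta> i) = 0 \<longrightarrow> (\<forall>i\<le>n. c i = 0))"

definition Hgt :: "nat \<Rightarrow> (nat \<Rightarrow> int) \<Rightarrow> int" where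
  "Hgt n v = Max ((\<lambda>i. \<bar>v i\<bar>) ` {0..n})"

definition Lform :: "nat \<Rightarrow> (nat \<Rightarrow> real) \<Rightarrow> (nat \<Rightarrow> int) \<Rightarrow> real" where
  "Lform n \<zeta> v = of_int (v 0) + (\<Sum>i=1..n. \<zeta> i * of_int (v i))"

definition Sdist :: "nat \<Rightarrow> (nat \<Rightarrow> real) \<Rightarrow> (nat \<Rightarrow> int) \<Rightarrow> real" where
  "Sdist n \<zeta> v = Max ((\<lambda>i. \<bar>\<zeta> i * of_int (v 0) - of_int (v i)\<bar>) ` {1..n})"

definition lin_sys :: "nat \<Rightarrow> (nat \<Rightarrow> real) \<Rightarrow> nat \<Rightarrow> real \<Rightarrow> real \<Rightarrow> bool" where
  "lin_sys n \<zeta> j X \<nu> \<longleftrightarrow>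
     (\<exists>V. (\<forall>k<j. int_vec n (V k) \<and> of_int (Hgt n (V k)) \<le> X
                  \<and> \<bar>Lform n \<zeta> (V k)\<bar> \<le> X powr (-\<nu>)) \<and> lin_indep n j V)"

definition sim_sys :: "nat \<Rightarrow> (nat \<Rightarrow> real) \<Rightarrow> nat \<Rightarrow> real \<Rightarrow> real \<Rightarrow> bool" where
  "sim_sys n \<zeta> j X \<nu> \<longleftrightarrow>
     (\<exists>V. (\<forall>k<j. int_vec n (V k) \<and> of_int \<bar>V k 0\<bar> \<le> X
                  \<and> Sdist n \<zeta> (V k) \<le> X powr (-\<nu>)) \<and> lin_indep n j V)"

definition w_exp :: "nat \<Rightarrow> nat \<Rightarrow> (nat \<Rightarrow> real) \<Rightarrow> ereal" where
  "w_exp n j \<zeta> = Sup {ereal \<nu> | \<nu>. \<forall>X0. \<exists>X\<ge>X0. lin_sys n \<zeta> j X \<nu>}"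

definition w_hat_exp :: "nat \<Rightarrow> nat \<Rightarrow> (nat \<Rightarrow> real) \<Rightarrow> ereal" where
  "w_hat_exp n j \<zeta> = Sup {ereal \<nu> | \<nu>. \<exists>X0. \<forall>X\<ge>X0. lin_sys n \<zeta> j X \<nu>}"

definition lambda_exp :: "nat \<Rightarrow> nat \<Rightarrow> (nat \<Rightarrow> real) \<Rightarrow> ereal" where
  "lambda_exp n j \<zeta> = Sup {ereal \<nu> | \<nu>. \<forall>X0. \<exists>X\<ge>X0. sim_sys n \<zeta> j X \<nu>}"

definition lambda_hat_exp :: "nat \<Rightarrow> nat \<Rightarrow> (nat \<Rightarrow> real) \<Rightarrow> ereal" where
  "lambda_hat_exp n j \<zeta> = Sup {ereal \<nu> | \<nu>. \<exists>X0. \<forall>X\<ge>X0. sim_sys n \<zeta> j X \<nu>}"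

definition best_lin :: "nat \<Rightarrow> (nat \<Rightarrow> real) \<Rightarrow> (nat \<Rightarrow> int) \<Rightarrow> bool" where
  "best_lin n \<zeta> v \<longleftrightarrow> int_vec n v \<and> nonzero_vec n v \<and>
     (\<forall>u. int_vec n u \<and> nonzero_vec n u \<and> Hgt n u < Hgt n v
          \<longrightarrow> \<bar>Lform n \<zeta> u\<bar> > \<bar>Lform n \<zeta> v\<bar>)"

definition best_sim :: "nat \<Rightarrow> (nat \<Rightarrow> real) \<Rightarrow> (nat \<Rightarrow> int) \<Rightarrow> bool" where
  "best_sim n \<zeta> v \<longleftrightarrow> int_vec n v \<and> v 0 \<noteq> 0 \<and>
     (\<forall>u. int_vec n u \<and> nonzero_vec n u \<and> \<bar>u 0\<bar> < \<bar>v 0\<bar>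
          \<longrightarrow> Sdist n \<zeta> u > Sdist n \<zeta> v) \<and>
     (\<forall>u. int_vec n u \<and> nonzero_vec n u \<and> \<bar>u 0\<bar> \<le> \<bar>v 0\<bar>
          \<longrightarrow> Sdist n \<zeta> u \<ge> Sdist n \<zeta> v)"

definition best_seq :: "((nat \<Rightarrow> int) \<Rightarrow> bool) \<Rightarrow> ((nat \<Rightarrow> int) \<Rightarrow> real)
                        \<Rightarrow> (nat \<Rightarrow> nat \<Rightarrow> int) \<Rightarrow> bool" where
  "best_seq B D b \<longleftrightarrow> (\<forall>k. B (b k)) \<and> (\<forall>k. D (b (Suc k)) < D (b k)) \<and>
     (\<forall>v. B v \<longrightarrow> (\<exists>k. v = b k \<or> v = - b k))"

end

theory Submission
  imports Defs
    "HOL-Real_Asymp.Real_Asymp"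
    "HOL-Analysis.Kronecker_Approximation_Theorem"
    "Jordan_Normal_Form.Determinant"
begin

text \<open>Both settings are instances of one situation: a height \<open>h\<close> and a distance \<open>D\<close> on integer
  vectors, with a sequence of minimal points \<open>b\<^sub>k\<close>. If \<open>\<nu>\<close> is below the uniform and \<open>\<mu>\<close> above the
  ordinary exponent, then \<open>h(b\<^sub>k)\<^bsup>-\<mu>\<^esup> < D(b\<^sub>k) \<le> h(b\<^sub>k\<^sub>+\<^sub>1)\<^bsup>-\<nu>\<^esup>\<close> for large \<open>k\<close>, hence
  \<open>h(b\<^sub>k\<^sub>+\<^sub>1) \<le> h(b\<^sub>k)\<^bsup>\<mu>/\<nu>\<^esup>\<close>. Whenever \<open>i\<close> consecutive minimal points are independent, they all solve
  the system with \<open>X\<close> the height of the last one, and iterating the growth estimate bounds the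
  distance of the first one by a power of \<open>X\<close>. Three consecutive minimal points are independent
  infinitely often. If \<open>n + 1\<close> consecutive ones are, their determinant is a nonzero integer;
  expanding it after a unimodular column operation that produces the small quantities gives
  \<open>\<nu> \<le> 1 + r + \<dots> + r\<^bsup>n-1\<^esup>\<close>, respectively \<open>\<nu> (1 + r\<^bsup>-1\<^esup> + \<dots> + r\<^bsup>-(n-1)\<^esup>) \<le> 1\<close>, with \<open>r = \<mu>/\<nu>\<close>.\<close>

section \<open>Minimal points and exponents\<close>

text \<open>The common shape of \<open>lin_sys\<close> and \<open>sim_sys\<close>, with height and
  distance left abstract so that both halves of the theorem share one argument.\<close>

definition approx_sys ::
  "nat \<Rightarrow> ((nat \<Rightarrow> int) \<Rightarrow> int) \<Rightarrow> ((nat \<Rightarrow> int) \<Rightarrow> real) \<Rightarrow> nat \<Rightarrow> real \<Rightarrow> real \<Rightarrow> bool" where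
  "approx_sys n h D j X \<nu> \<longleftrightarrow>
     (\<exists>V. (\<forall>k<j. int_vec n (V k) \<and> of_int (h (V k)) \<le> X \<and> D (V k) \<le> X powr (-\<nu>))
          \<and> lin_indep n j V)"

definition approx_exp ::
  "nat \<Rightarrow> ((nat \<Rightarrow> int) \<Rightarrow> int) \<Rightarrow> ((nat \<Rightarrow> int) \<Rightarrow> real) \<Rightarrow> nat \<Rightarrow> ereal" where
  "approx_exp n h D j = Sup {ereal \<nu> | \<nu>. \<forall>X0. \<exists>X\<ge>X0. approx_sys n h D j X \<nu>}"

definition approx_hat_exp ::
  "nat \<Rightarrow> ((nat \<Rightarrow> int) \<Rightarrow> int) \<Rightarrow> ((nat \<Rightarrow> int) \<Rightarrow> real) \<Rightarrow> nat \<Rightarrow> ereal" where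
  "approx_hat_exp n h D j = Sup {ereal \<nu> | \<nu>. \<exists>X0. \<forall>X\<ge>X0. approx_sys n h D j X \<nu>}"

text \<open>Each new point has least height among the nonzero vectors closer than its predecessor.
  Ties in height are allowed, so such a sequence can be built without further assumptions, and
  sequences of best approximations turn out to be instances.\<close>

definition minimal_seq ::
  "nat \<Rightarrow> ((nat \<Rightarrow> int) \<Rightarrow> int) \<Rightarrow> ((nat \<Rightarrow> int) \<Rightarrow> real) \<Rightarrow> (nat \<Rightarrow> nat \<Rightarrow> int) \<Rightarrow> bool" where
  "minimal_seq n h D b \<longleftrightarrow>
     (\<forall>k. int_vec n (b k) \<and> nonzero_vec n (b k) \<and> D (b (Suc k)) < D (b k) \<and>
          h (b k) \<le> h (b (Suc k)) \<and>
          (\<forall>u. int_vec n u \<longrightarrow> nonzero_vec n u \<longrightarrow> h u < h (b (Suc k)) \<longrightarrow> D (b k) \<le> D u))"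

lemma approx_hat_le_exp: "approx_hat_exp n h D j \<le> approx_exp n h D j"
  unfolding approx_exp_def approx_hat_exp_def
proof (rule Sup_subset_mono, safe)
  fix \<nu> X0
  assume "\<forall>X\<ge>X0. approx_sys n h D j X \<nu>"
  then have "\<forall>X1. \<exists>X\<ge>X1. approx_sys n h D j X \<nu>"
    by (meson max.cobounded1 max.cobounded2)
  then show "\<exists>\<nu>'. ereal \<nu> = ereal \<nu>' \<and> (\<forall>X0. \<exists>X\<ge>X0. approx_sys n h D j X \<nu>')"
    by blast
qed

lemma le_approx_hatI:
  assumes "\<And>X. X \<ge> X0 \<Longrightarrow> approx_sys n h D j X \<nu>"
  shows "ereal \<nu> \<le> approx_hat_exp n h D j"
  unfolding approx_hat_exp_def using assms by (intro Sup_upper) blast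

lemma le_approx_expI:
  assumes "\<And>X0. \<exists>X\<ge>X0. approx_sys n h D j X \<nu>"
  shows "ereal \<nu> \<le> approx_exp n h D j"
  unfolding approx_exp_def using assms by (intro Sup_upper) blast

lemma lin_indep_1: "lin_indep n 1 V \<longleftrightarrow> nonzero_vec n (V 0)"
proof
  assume L: "lin_indep n 1 V"
  show "nonzero_vec n (V 0)"
  proof (rule ccontr)
    assume "\<not> nonzero_vec n (V 0)"
    then have "\<forall>i\<le>n. (\<Sum>k<1. (\<lambda>_. 1) k * real_of_int (V k i)) = 0"
      by (simp add: nonzero_vec_def)
    then show False
      using L[unfolded lin_indep_def, rule_format, of "\<lambda>_. 1" 0] by simp
  qed
next
  assume "nonzero_vec n (V 0)"
  then show "lin_indep n 1 V" by (auto simp: lin_indep_def nonzero_vec_def)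
qed

lemma lin_indep_prefix:
  assumes "lin_indep n m V" "j \<le> m"
  shows "lin_indep n j V"
  unfolding lin_indep_def
proof (intro allI impI)
  fix c :: "nat \<Rightarrow> real" and k
  assume *: "\<forall>i\<le>n. (\<Sum>k<j. c k * real_of_int (V k i)) = 0" and k: "k < j"
  define d where "d k = (if k < j then c k else 0)" for k
  have "(\<Sum>k<m. d k * real_of_int (V k i)) = (\<Sum>k<j. c k * real_of_int (V k i))" for i
    using assms(2) by (intro sum.mono_neutral_cong_right) (auto simp: d_def)
  with * have "\<forall>i\<le>n. (\<Sum>k<m. d k * real_of_int (V k i)) = 0" by simp
  then have "\<forall>k<m. d k = 0"
    using assms(1) unfolding lin_indep_def by blast
  then show "c k = 0" using k assms(2) by (auto simp: d_def dest!: spec[of _ k])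
qed

lemma lin_indep_unit:
  assumes "j \<le> Suc n"
  shows "lin_indep n j (\<lambda>k i. if i = k then 1 else 0)"
  unfolding lin_indep_def
proof (intro allI impI)
  fix c :: "nat \<Rightarrow> real" and k
  assume *: "\<forall>i\<le>n. (\<Sum>k<j. c k * real_of_int (if i = k then 1 else 0)) = 0" and k: "k < j"
  have "(\<Sum>k'<j. c k' * real_of_int (if k = k' then 1 else 0)) = 0"
    using * k assms by auto
  moreover have "(\<Sum>k'<j. c k' * real_of_int (if k = k' then 1 else 0)) = c k"
    using k by (simp add: if_distrib[of real_of_int] if_distrib[of "\<lambda>x. _ * x"] cong: if_cong)
  ultimately show "c k = 0" by simp
qed

text \<open>For negative \<open>\<nu>\<close> the bound \<open>X powr (-\<nu>)\<close> tends to
  infinity with X, so the unit vectors solve the system for all large X, whatever \<open>h\<close>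
  and \<open>D\<close> are.\<close>

lemma approx_exp_nonneg:
  assumes j: "j \<le> Suc n"
  shows "0 \<le> approx_exp n h D j"
proof (rule dense_le)
  fix x :: ereal
  assume x: "x < 0"
  define V :: "nat \<Rightarrow> nat \<Rightarrow> int" where "V = (\<lambda>k i. if i = k then 1 else 0)"
  have "ereal \<nu> \<le> approx_exp n h D j" if \<nu>: "\<nu> < 0" for \<nu>
  proof (rule le_approx_expI)
    fix X0 :: real
    have lim: "filterlim (\<lambda>X::real. X powr (-\<nu>)) at_top at_top"
      using \<nu> by real_asymp
    have "\<forall>\<^sub>F X in at_top. X0 \<le> X \<and> (\<forall>k<j. of_int (h (V k)) \<le> X \<and> D (V k) \<le> X powr (-\<nu>))"
    proof (intro eventually_conj)
      show "\<forall>\<^sub>F X in at_top. X0 \<le> X" by (rule eventually_ge_at_top)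
      have "\<forall>\<^sub>F X in at_top. \<forall>k\<in>{..<j}. of_int (h (V k)) \<le> X \<and> D (V k) \<le> X powr (-\<nu>)"
        using lim unfolding filterlim_at_top
        by (intro eventually_ball_finite) (auto intro!: eventually_conj eventually_ge_at_top)
      then show "\<forall>\<^sub>F X in at_top. \<forall>k<j. of_int (h (V k)) \<le> X \<and> D (V k) \<le> X powr (-\<nu>)"
        by (rule eventually_mono) auto
    qed
    then obtain X where "X0 \<le> X" "\<forall>k<j. of_int (h (V k)) \<le> X \<and> D (V k) \<le> X powr (-\<nu>)"
      using eventually_happens'[OF trivial_limit_at_top_linorder] by blast
    moreover have "int_vec n (V k)" if "k < j" for k
      using that j by (auto simp: int_vec_def V_def)
    ultimately have "approx_sys n h D j X \<nu>"
      unfolding approx_sys_def using lin_indep_unit[OF j] V_def by (intro exI[of _ V]) auto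
    then show "\<exists>X\<ge>X0. approx_sys n h D j X \<nu>" using \<open>X0 \<le> X\<close> by blast
  qed
  then show "x \<le> approx_exp n h D j" using x by (cases x) auto
qed

section \<open>Abstract approximation problems and their minimal points\<close>

text \<open>The properties shared by the two settings. \<open>dirichlet\<close> asks for some
  positive uniform exponent, which makes distances arbitrarily small; \<open>homogeneous\<close>
  serves to exclude that consecutive minimal points are proportional.\<close>

locale approximation =
  fixes n :: nat and h :: "(nat \<Rightarrow> int) \<Rightarrow> int" and D :: "(nat \<Rightarrow> int) \<Rightarrow> real"
  assumes h_nonneg: "h v \<ge> 0"
    and D_pos: "int_vec n v \<Longrightarrow> nonzero_vec n v \<Longrightarrow> D v > 0"
    and finite_bounded: "finite {v. int_vec n v \<and> h v \<le> B \<and> D v \<le> C}"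
    and homogeneous: "int_vec n u \<Longrightarrow> int_vec n v \<Longrightarrow> (\<And>i. i \<le> n \<Longrightarrow> of_int (u i) = t * of_int (v i))
          \<Longrightarrow> of_int (h u) = \<bar>t\<bar> * of_int (h v) \<and> D u = \<bar>t\<bar> * D v"
    and dirichlet: "\<exists>\<alpha>>0. \<exists>X0. \<forall>X\<ge>X0. approx_sys n h D 1 X \<alpha>"
begin

lemma approx_hat_pos: "0 < approx_hat_exp n h D 1"
proof -
  obtain \<alpha> X0 where "\<alpha> > 0" "\<forall>X\<ge>X0. approx_sys n h D 1 X \<alpha>"
    using dirichlet by blast
  then have "ereal \<alpha> \<le> approx_hat_exp n h D 1" by (intro le_approx_hatI) auto
  with \<open>\<alpha> > 0\<close> show ?thesis by (meson ereal_less(2) less_le_trans)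
qed

lemma exists_small:
  assumes "e > 0"
  shows "\<exists>v. int_vec n v \<and> nonzero_vec n v \<and> D v < e"
proof -
  obtain \<alpha> X0 where \<alpha>: "\<alpha> > 0" "\<forall>X\<ge>X0. approx_sys n h D 1 X \<alpha>"
    using dirichlet by blast
  have "((\<lambda>X::real. X powr (-\<alpha>)) \<longlongrightarrow> 0) at_top"
    using \<alpha> by (intro tendsto_neg_powr filterlim_ident) auto
  then have "\<forall>\<^sub>F X in at_top. X powr (-\<alpha>) < e \<and> X \<ge> X0"
    using assms by (intro eventually_conj eventually_ge_at_top) (auto dest: order_tendstoD)
  then obtain X where X: "X powr (-\<alpha>) < e" "X \<ge> X0"
    using eventually_happens'[OF trivial_limit_at_top_linorder] by blast
  with \<alpha> obtain V where V: "\<forall>k<1. int_vec n (V k) \<and> of_int (h (V k)) \<le> X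
      \<and> D (V k) \<le> X powr (-\<alpha>)" "lin_indep n 1 V"
    unfolding approx_sys_def by blast
  show ?thesis
    by (rule exI[of _ "V 0"]) (use V X in \<open>auto simp: lin_indep_1 simp del: One_nat_def\<close>)
qed

text \<open>Greedy construction: the next point is a vector of least height among those strictly
  closer than the current one. It serves the unconditional parts, where no sequence of best
  approximations is given.\<close>

lemma minimal_seq_exists: "\<exists>b. minimal_seq n h D b"
proof -
  define P where "P e v \<longleftrightarrow> int_vec n v \<and> nonzero_vec n v \<and> D v < e \<and>
    (\<forall>u. int_vec n u \<longrightarrow> nonzero_vec n u \<longrightarrow> h u < h v \<longrightarrow> e \<le> D u)" for e v
  have ex: "\<exists>v. P e v" if "e > 0" for e
  proof -
    define Q where "Q v \<longleftrightarrow> int_vec n v \<and> nonzero_vec n v \<and> D v < e" for v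
    obtain v0 where "Q v0" using exists_small[OF \<open>e > 0\<close>] Q_def by blast
    then obtain v where v: "Q v" "\<And>u. Q u \<Longrightarrow> nat (h v) \<le> nat (h u)"
      using ex_has_least_nat[of Q v0 "\<lambda>v. nat (h v)"] by blast
    have "e \<le> D u" if "int_vec n u" "nonzero_vec n u" "h u < h v" for u
    proof (rule ccontr)
      assume "\<not> e \<le> D u"
      then have "nat (h v) \<le> nat (h u)" using that v(2) by (simp add: Q_def)
      then show False using that(3) h_nonneg[of u] by simp
    qed
    then show ?thesis using v(1) by (auto simp: P_def Q_def)
  qed
  define next_of where "next_of v = (SOME u. P (D v) u)" for v
  define b where "b = rec_nat (SOME u. P 1 u) (\<lambda>_. next_of)"
  have bS: "b (Suc k) = next_of (b k)" for k by (simp add: b_def)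
  have b0: "P 1 (b 0)" using someI_ex[OF ex[of 1]] by (simp add: b_def)
  have next_P: "P (D v) (next_of v)" if "int_vec n v" "nonzero_vec n v" for v
    unfolding next_of_def using someI_ex[OF ex[OF D_pos[OF that]]] .
  have bP: "int_vec n (b k) \<and> nonzero_vec n (b k)" for k
  proof (induction k)
    case 0
    then show ?case using b0 by (simp add: P_def)
  next
    case (Suc k)
    then show ?case using next_P[of "b k"] by (simp add: bS P_def)
  qed
  have step: "P (D (b k)) (b (Suc k))" for k
    using next_P bP by (simp add: bS)
  have mono: "h (b k) \<le> h (b (Suc k))" for k
  proof -
    \<comment> \<open>Every point was chosen below some threshold \<open>e\<close>. Its successor
      lies below \<open>e\<close> too, so it was a candidate for the earlier choice and cannot have
      smaller height.\<close>
    obtain e where e: "P e (b k)" using b0 step by (cases k) auto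
    have "D (b (Suc k)) < e" using e step[of k] by (auto simp: P_def)
    then show ?thesis using e bP[of "Suc k"] by (auto simp: P_def not_less[symmetric])
  qed
  show ?thesis
    using bP mono step by (intro exI[of _ b]) (auto simp: minimal_seq_def P_def)
qed

context
  fixes b
  assumes b: "minimal_seq n h D b"
begin

lemma minimal_seq_vec: "int_vec n (b k)" "nonzero_vec n (b k)"
  using b by (auto simp: minimal_seq_def)

lemma minimal_seq_D_pos: "D (b k) > 0"
  by (rule D_pos minimal_seq_vec)+

lemma minimal_seq_D_less: "j < k \<Longrightarrow> D (b k) < D (b j)"
  using b lift_Suc_mono_less[of "\<lambda>k. - D (b k)" j k] by (simp add: minimal_seq_def)

lemma minimal_seq_D_le: "j \<le> k \<Longrightarrow> D (b k) \<le> D (b j)"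
  using minimal_seq_D_less[of j k] by (cases "j = k") auto

lemma minimal_seq_h_le: "j \<le> k \<Longrightarrow> h (b j) \<le> h (b k)"
  using b lift_Suc_mono_le[of "\<lambda>k. h (b k)" j k] by (simp add: minimal_seq_def)

text \<open>Strict decrease of \<open>D\<close> makes the points distinct, and only finitely many
  vectors have bounded height and distance at most \<open>D (b 0)\<close>.\<close>

lemma minimal_seq_h_unbounded: "filterlim (\<lambda>k. real_of_int (h (b k))) at_top sequentially"
  unfolding filterlim_at_top
proof
  fix Z :: real
  have "inj b"
  proof (rule linorder_injI)
    fix j k :: nat assume "j < k"
    then show "b j \<noteq> b k" using minimal_seq_D_less[of j k] by auto
  qed
  have "\<exists>k. h (b k) > \<lceil>Z\<rceil>"
  proof (rule ccontr)
    assume "\<not> ?thesis"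
    then have "range b \<subseteq> {v. int_vec n v \<and> h v \<le> \<lceil>Z\<rceil> \<and> D v \<le> D (b 0)}"
      using minimal_seq_vec minimal_seq_D_le by (auto simp: not_less)
    then have "finite (range b)" using finite_bounded finite_subset by blast
    then show False using \<open>inj b\<close> finite_imageD by blast
  qed
  then obtain k where k: "h (b k) > \<lceil>Z\<rceil>" by blast
  have "Z \<le> real_of_int (h (b j))" if "j \<ge> k" for j
    using k minimal_seq_h_le[OF that] by linarith
  then show "\<forall>\<^sub>F k in sequentially. Z \<le> real_of_int (h (b k))"
    unfolding eventually_sequentially by blast
qed

lemma minimal_seq_h_ge: "\<forall>\<^sub>F k in sequentially. Z \<le> real_of_int (h (b k))"
  using minimal_seq_h_unbounded unfolding filterlim_at_top by blast

text \<open>No nonzero vector below the height H of the next point is closer than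
  \<open>b k\<close>, so a solution of the system at X < H bounds \<open>D (b k)\<close>. Height H
  itself is not covered; the estimate there comes from letting X tend to H from the left.\<close>

lemma minimal_seq_D_upper:
  assumes \<nu>: "ereal \<nu> < approx_hat_exp n h D 1"
  shows "\<forall>\<^sub>F k in sequentially. D (b k) \<le> of_int (h (b (Suc k))) powr (-\<nu>)"
proof -
  obtain \<nu>' X0 where \<nu>': "\<nu> < \<nu>'" "\<forall>X\<ge>X0. approx_sys n h D 1 X \<nu>'"
    using \<nu> unfolding approx_hat_exp_def less_Sup_iff by auto
  have "D (b k) \<le> of_int (h (b (Suc k))) powr (-\<nu>)"
    if k: "real_of_int (h (b (Suc k))) \<ge> max X0 1 + 1" for k
  proof -
    define H where "H = real_of_int (h (b (Suc k)))"
    have *: "D (b k) \<le> X powr (-\<nu>)" if X: "max X0 1 < X" "X < H" for X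
    proof -
      obtain V where V: "\<forall>k<1. int_vec n (V k) \<and> of_int (h (V k)) \<le> X
          \<and> D (V k) \<le> X powr (-\<nu>')" "lin_indep n 1 V"
        using \<nu>' X unfolding approx_sys_def by (metis less_le max.strict_boundedE)
      have v: "int_vec n (V 0)" "nonzero_vec n (V 0)" "of_int (h (V 0)) \<le> X"
          "D (V 0) \<le> X powr (-\<nu>')"
        using V by (auto simp: lin_indep_1 simp del: One_nat_def)
      have "D (b k) \<le> D (V 0)"
        using b v X unfolding minimal_seq_def H_def by force
      also have "\<dots> \<le> X powr (-\<nu>')" by fact
      also have "\<dots> \<le> X powr (-\<nu>)" using X \<nu>' by (intro powr_mono) auto
      finally show ?thesis .
    qed
    have H: "H > max X0 1" using k unfolding H_def by linarith
    have "((\<lambda>X. X powr (-\<nu>)) \<longlongrightarrow> H powr (-\<nu>)) (at_left H)"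
      using H by (intro tendsto_intros) auto
    moreover have "\<forall>\<^sub>F X in at_left H. D (b k) \<le> X powr (-\<nu>)"
      using eventually_at_left_real[OF H] by eventually_elim (use * in auto)
    ultimately show ?thesis
      unfolding H_def[symmetric] by (rule tendsto_lowerbound) auto
  qed
  moreover have "\<forall>\<^sub>F k in sequentially. max X0 1 + 1 \<le> real_of_int (h (b (Suc k)))"
    using minimal_seq_h_ge by (subst eventually_sequentially_Suc)
  ultimately show ?thesis by (auto elim: eventually_mono)
qed

text \<open>Otherwise \<open>b k\<close> itself would solve the system with X equal to its height,
  which is impossible for large X because \<open>\<mu>\<close> exceeds the ordinary
  exponent.\<close>

lemma minimal_seq_D_lower:
  assumes \<mu>: "approx_exp n h D 1 < ereal \<mu>"
  shows "\<forall>\<^sub>F k in sequentially. of_int (h (b k)) powr (-\<mu>) < D (b k)"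
proof -
  have "\<not> (\<forall>X0. \<exists>X\<ge>X0. approx_sys n h D 1 X \<mu>)"
    using le_approx_expI[of n h D 1 \<mu>] \<mu> by (meson not_less)
  then obtain X0 where X0: "\<And>X. X \<ge> X0 \<Longrightarrow> \<not> approx_sys n h D 1 X \<mu>" by blast
  have "of_int (h (b k)) powr (-\<mu>) < D (b k)" if "X0 \<le> real_of_int (h (b k))" for k
  proof (rule ccontr)
    assume "\<not> ?thesis"
    then have "approx_sys n h D 1 (of_int (h (b k))) \<mu>"
      unfolding approx_sys_def using minimal_seq_vec
      by (intro exI[of _ "\<lambda>_. b k"]) (auto simp: lin_indep_1 simp del: One_nat_def)
    then show False using X0 that by blast
  qed
  then show ?thesis using minimal_seq_h_ge[of X0] by (auto elim: eventually_mono)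
qed

lemma minimal_seq_growth:
  assumes \<nu>: "ereal \<nu> < approx_hat_exp n h D 1" "0 < \<nu>"
    and \<mu>: "approx_exp n h D 1 < ereal \<mu>"
  shows "\<forall>\<^sub>F k in sequentially. real_of_int (h (b (Suc k))) \<le> of_int (h (b k)) powr (\<mu> / \<nu>)"
  using minimal_seq_D_upper[OF \<nu>(1)] minimal_seq_D_lower[OF \<mu>] minimal_seq_h_ge[of 1]
proof eventually_elim
  case (elim k)
  define x y where "x = real_of_int (h (b k))" and "y = real_of_int (h (b (Suc k)))"
  have xy: "x \<ge> 1" "y \<ge> 1"
    using elim(3) minimal_seq_h_le[of k "Suc k"] by (auto simp: x_def y_def)
  have "x powr (-\<mu>) < y powr (-\<nu>)" using elim by (simp add: x_def y_def)
  then have "y powr \<nu> < x powr \<mu>" using xy by (simp add: powr_minus field_simps)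
  then have "(y powr \<nu>) powr (1 / \<nu>) \<le> (x powr \<mu>) powr (1 / \<nu>)"
    using \<nu> by (intro powr_mono2) auto
  then show ?case using \<nu> xy by (simp add: powr_powr x_def[symmetric] y_def[symmetric])
qed

lemma minimal_seq_growth_iterated:
  assumes "\<forall>\<^sub>F k in sequentially. real_of_int (h (b (Suc k))) \<le> of_int (h (b k)) powr r" "r > 0"
  shows "\<forall>\<^sub>F k in sequentially. \<forall>j. real_of_int (h (b (k + j))) \<le> of_int (h (b k)) powr (r ^ j)"
proof -
  obtain K where K: "\<And>k. k \<ge> K \<Longrightarrow> real_of_int (h (b (Suc k))) \<le> of_int (h (b k)) powr r"
    using assms(1) unfolding eventually_sequentially by blast
  have "real_of_int (h (b (k + j))) \<le> of_int (h (b k)) powr (r ^ j)"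
    if k: "k \<ge> K" "1 \<le> real_of_int (h (b k))" for k j
  proof (induction j)
    case 0
    then show ?case using k by simp
  next
    case (Suc j)
    have "real_of_int (h (b (k + Suc j))) \<le> of_int (h (b (k + j))) powr r"
      using K[of "k + j"] k by simp
    also have "\<dots> \<le> (of_int (h (b k)) powr (r ^ j)) powr r"
      using Suc assms(2) h_nonneg by (intro powr_mono2) auto
    finally show ?case by (simp add: powr_powr mult.commute)
  qed
  note * = this
  show ?thesis
    using minimal_seq_h_ge[of 1] eventually_ge_at_top[of K] by eventually_elim (use * in blast)
qed

text \<open>X is the height of the last of the \<open>i\<close> points, and x that of the second.
  The first point is the farthest, at distance at most \<open>x powr (-\<nu>)\<close>, and X is at
  most \<open>x powr (r ^ (i - 2))\<close>. The disjunction in \<open>growth\<close> admits i = 2,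
  where X = x, even if the ordinary exponent is infinite and no growth rate is available.\<close>

lemma approx_exp_ge_real:
  assumes inf: "infinite {k. lin_indep n i (\<lambda>j. b (k + j))}" and i: "i \<ge> 2"
    and \<nu>: "ereal \<nu> < approx_hat_exp n h D 1" "0 < \<nu>"
    and r: "r > 0"
    and growth: "i = 2 \<or>
      (\<forall>\<^sub>F k in sequentially. real_of_int (h (b (Suc k))) \<le> of_int (h (b k)) powr r)"
  shows "ereal (\<nu> / r ^ (i - 2)) \<le> approx_exp n h D i"
proof (rule le_approx_expI)
  fix X0 :: real
  have it: "\<forall>\<^sub>F k in sequentially.
      real_of_int (h (b (Suc k + (i - 2)))) \<le> of_int (h (b (Suc k))) powr (r ^ (i - 2))"
  proof (cases "i = 2")
    case True
    have "\<forall>\<^sub>F k in sequentially. 1 \<le> real_of_int (h (b (Suc k)))"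
      by (subst eventually_sequentially_Suc) (rule minimal_seq_h_ge)
    then show ?thesis by eventually_elim (simp add: True)
  next
    case False
    have "\<forall>\<^sub>F k in sequentially. \<forall>j. real_of_int (h (b (Suc k + j)))
        \<le> of_int (h (b (Suc k))) powr (r ^ j)"
      using minimal_seq_growth_iterated[OF _ r] growth False
      by (subst eventually_sequentially_Suc) auto
    then show ?thesis by (rule eventually_mono) blast
  qed
  have "\<forall>\<^sub>F k in sequentially. max X0 1 \<le> real_of_int (h (b (Suc k)))"
    by (subst eventually_sequentially_Suc) (rule minimal_seq_h_ge)
  with it minimal_seq_D_upper[OF \<nu>(1)]
  have "\<forall>\<^sub>F k in sequentially.
      real_of_int (h (b (Suc k + (i - 2)))) \<le> of_int (h (b (Suc k))) powr (r ^ (i - 2)) \<and>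
      D (b k) \<le> of_int (h (b (Suc k))) powr (-\<nu>) \<and> max X0 1 \<le> real_of_int (h (b (Suc k)))"
    by eventually_elim blast
  then obtain K where K: "\<And>k. k \<ge> K \<Longrightarrow>
      real_of_int (h (b (Suc k + (i - 2)))) \<le> of_int (h (b (Suc k))) powr (r ^ (i - 2)) \<and>
      D (b k) \<le> of_int (h (b (Suc k))) powr (-\<nu>) \<and> max X0 1 \<le> real_of_int (h (b (Suc k)))"
    unfolding eventually_sequentially by blast
  obtain k where k: "k \<ge> K" "lin_indep n i (\<lambda>j. b (k + j))"
    using inf unfolding infinite_nat_iff_unbounded_le by blast
  define x X s where "x = real_of_int (h (b (Suc k)))" and "X = real_of_int (h (b (Suc k + (i - 2))))"
    and "s = r ^ (i - 2)"
  have s: "s > 0" using r by (simp add: s_def)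
  have x: "X \<le> x powr s" "D (b k) \<le> x powr (-\<nu>)" "X0 \<le> x" "1 \<le> x"
    using K[OF k(1)] by (auto simp: x_def X_def s_def)
  have xX: "x \<le> X"
    using minimal_seq_h_le[of "Suc k" "Suc k + (i - 2)"] by (simp add: x_def X_def)
  have "X powr (\<nu> / s) \<le> (x powr s) powr (\<nu> / s)"
    using x xX \<nu> s by (intro powr_mono2) auto
  then have "X powr (\<nu> / s) \<le> x powr \<nu>" using s by (simp add: powr_powr)
  then have "x powr (-\<nu>) \<le> X powr (-(\<nu> / s))"
    using x xX by (simp add: powr_minus le_imp_inverse_le)
  then have D: "D (b k) \<le> X powr (-(\<nu> / s))" using x by simp
  have "approx_sys n h D i X (\<nu> / s)"
    unfolding approx_sys_def
  proof (intro exI[of _ "\<lambda>j. b (k + j)"] conjI allI impI)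
    fix j assume j: "j < i"
    show "int_vec n (b (k + j))" by (rule minimal_seq_vec)
    show "real_of_int (h (b (k + j))) \<le> X"
      using minimal_seq_h_le[of "k + j" "Suc k + (i - 2)"] j i by (simp add: X_def)
    show "D (b (k + j)) \<le> X powr (-(\<nu> / s))"
      using minimal_seq_D_le[of k "k + j"] D by simp
  qed (rule k)
  then show "\<exists>X\<ge>X0. approx_sys n h D i X (\<nu> / r ^ (i - 2))"
    using x xX by (intro exI[of _ X]) (auto simp: s_def)
qed

theorem approx_exp_ge:
  assumes inf: "infinite {k. lin_indep n i (\<lambda>j. b (k + j))}" and i: "2 \<le> i" "i \<le> Suc n"
  shows "approx_hat_exp n h D 1 ^ (i - 1) / approx_exp n h D 1 ^ (i - 2) \<le> approx_exp n h D i"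
proof (cases "i = 2")
  case True
  \<comment> \<open>The denominator has exponent 0, so the claim compares two exponents, infinite
    values included. The rate 1 passed below is a dummy, raised only to the power 0.\<close>
  have "approx_hat_exp n h D 1 \<le> approx_exp n h D i"
  proof (rule dense_le)
    fix y assume y: "y < approx_hat_exp n h D 1"
    show "y \<le> approx_exp n h D i"
    proof (cases "y \<le> 0")
      case True
      then show ?thesis using approx_exp_nonneg[OF i(2)] by (rule order_trans)
    next
      case False
      with y obtain \<nu> where "y = ereal \<nu>" "0 < \<nu>" by (cases y) auto
      then show ?thesis
        using approx_exp_ge_real[OF inf i(1), of \<nu> 1] y \<open>i = 2\<close> by simp
    qed
  qed
  then show ?thesis using True by (simp add: divide_ereal_def one_ereal_def)
next
  case False
  show ?thesis
  proof (cases "approx_exp n h D 1")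
    case PInf
    \<comment> \<open>Division by infinity gives 0 in \<open>ereal\<close>, even for an infinite
      numerator, so nonnegativity suffices.\<close>
    then show ?thesis
      using False i approx_exp_nonneg[OF i(2), of h D] by (simp add: ereal_divide_eq_0_iff)
  next
    case MInf
    then show ?thesis using approx_exp_nonneg[of 1 n h D] by auto
  next
    case (real w)
    obtain wh where wh: "approx_hat_exp n h D 1 = ereal wh" "0 < wh" "wh \<le> w"
      using approx_hat_le_exp[of n h D 1] approx_hat_pos real
      by (cases "approx_hat_exp n h D 1") auto
    \<comment> \<open>The bound \<open>\<nu> / r ^ (i - 2)\<close> for
      \<open>\<nu> = wh - \<epsilon>\<close> and
      \<open>r = (w + \<epsilon>) / (wh - \<epsilon>)\<close>; letting \<open>\<epsilon>\<close>
      tend to 0 yields the exponents themselves.\<close>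
    define f where "f \<epsilon> = (wh - \<epsilon>) / ((w + \<epsilon>) / (wh - \<epsilon>)) ^ (i - 2)" for \<epsilon>
    have "(f \<longlongrightarrow> f 0) (at_right 0)"
      unfolding f_def using wh by (intro tendsto_eq_intros refl | simp)+
    then have "((\<lambda>\<epsilon>. ereal (f \<epsilon>)) \<longlongrightarrow> ereal (f 0)) (at_right 0)" by simp
    moreover have "\<forall>\<^sub>F \<epsilon> in at_right 0. ereal (f \<epsilon>) \<le> approx_exp n h D i"
      using eventually_at_right_real[OF wh(2)]
    proof eventually_elim
      case (elim \<epsilon>)
      have "\<forall>\<^sub>F k in sequentially.
          real_of_int (h (b (Suc k))) \<le> of_int (h (b k)) powr ((w + \<epsilon>) / (wh - \<epsilon>))"
        using elim wh real by (intro minimal_seq_growth) auto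
      then show ?case
        unfolding f_def using elim wh
        by (intro approx_exp_ge_real[OF inf i(1)]) auto
    qed
    ultimately have "ereal (f 0) \<le> approx_exp n h D i"
      by (rule tendsto_upperbound) auto
    moreover have "f 0 = wh ^ (i - 1) / w ^ (i - 2)"
    proof -
      have "i - 1 = Suc (i - 2)" using i by simp
      then show ?thesis using wh by (simp add: f_def power_divide)
    qed
    ultimately show ?thesis
      using wh real by (simp add: ereal_power)
  qed
qed

end
end

section \<open>Inequalities between exponents from product estimates\<close>

text \<open>A negative \<open>s\<close> would send the right-hand side to 0, against the infinitely
  many k with \<open>P k\<close>. In this way a comparison of powers becomes one of exponents, and
  the constant \<open>C\<close> disappears.\<close>

lemma exponent_nonneg:
  fixes x :: "nat \<Rightarrow> real"
  assumes inf: "infinite {k. P k}" and x: "filterlim x at_top sequentially"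
    and ev: "\<forall>\<^sub>F k in sequentially. P k \<longrightarrow> 1 \<le> C * x k powr s"
  shows "0 \<le> s"
proof (rule ccontr)
  assume "\<not> 0 \<le> s"
  then have "((\<lambda>k. x k powr s) \<longlongrightarrow> 0) sequentially"
    using x by (intro tendsto_neg_powr) auto
  then have "((\<lambda>k. C * x k powr s) \<longlongrightarrow> C * 0) sequentially"
    by (intro tendsto_intros)
  then have "\<forall>\<^sub>F k in sequentially. C * x k powr s < 1"
    by (rule order_tendstoD) simp
  with ev have "\<forall>\<^sub>F k in sequentially. \<not> P k" by eventually_elim auto
  then show False
    using inf unfolding eventually_sequentially infinite_nat_iff_unbounded_le by blast
qed

context approximation
begin

context
  fixes b
  assumes b: "minimal_seq n h D b"
begin

text \<open>Everything is measured by x, the height of \<open>b (Suc k)\<close>: the distance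
  contributes \<open>-\<nu>\<close> to the exponent of x, and the height j steps later at most
  \<open>r ^ j\<close>. By \<open>exponent_nonneg\<close> the total is nonnegative; then
  \<open>\<nu>\<close> and \<open>\<mu>\<close> tend to the two exponents.\<close>

lemma approx_hat_le_power_sum:
  assumes inf: "infinite {k. P k}"
    and bound: "\<And>k. P k \<Longrightarrow> 1 \<le> C * D (b k) * (\<Prod>j<m. real_of_int (h (b (Suc k + j))))"
    and C: "C \<ge> 0"
    and wh: "approx_hat_exp n h D 1 = ereal wh" and w: "approx_exp n h D 1 = ereal w"
  shows "wh \<le> (\<Sum>j<m. (w / wh) ^ j)"
proof -
  have pos: "0 < wh" "wh \<le> w"
    using approx_hat_le_exp[of n h D 1] approx_hat_pos wh w by auto
  define g where "g \<epsilon> = - (wh - \<epsilon>) + (\<Sum>j<m. ((w + \<epsilon>) / (wh - \<epsilon>)) ^ j)" for \<epsilon>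
  have "(g \<longlongrightarrow> g 0) (at_right 0)"
    unfolding g_def using pos by (intro tendsto_eq_intros refl | simp)+
  moreover have "\<forall>\<^sub>F \<epsilon> in at_right 0. 0 \<le> g \<epsilon>"
    using eventually_at_right_real[OF pos(1)]
  proof eventually_elim
    case (elim \<epsilon>)
    define \<nu> \<mu> r where "\<nu> = wh - \<epsilon>" and "\<mu> = w + \<epsilon>" and "r = \<mu> / \<nu>"
    have \<nu>: "0 < \<nu>" "ereal \<nu> < approx_hat_exp n h D 1" "approx_exp n h D 1 < ereal \<mu>" and r: "r > 0"
      using elim pos wh w by (auto simp: \<nu>_def \<mu>_def r_def)
    have "\<forall>\<^sub>F k in sequentially. \<forall>j. real_of_int (h (b (Suc k + j))) \<le> of_int (h (b (Suc k))) powr (r ^ j)"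
      using minimal_seq_growth_iterated[OF b minimal_seq_growth[OF b \<nu>(2,1,3)] r[unfolded r_def]]
      unfolding r_def by (subst eventually_sequentially_Suc)
    then have "\<forall>\<^sub>F k in sequentially. P k \<longrightarrow>
        1 \<le> C * real_of_int (h (b (Suc k))) powr (- \<nu> + (\<Sum>j<m. r ^ j))"
      using minimal_seq_D_upper[OF b \<nu>(2)] eventually_all_ge_at_top[OF minimal_seq_h_ge[OF b, of 1]]
    proof eventually_elim
      case (elim k)
      show ?case
      proof
        define x where "x = real_of_int (h (b (Suc k)))"
        assume "P k"
        then have "1 \<le> C * D (b k) * (\<Prod>j<m. real_of_int (h (b (Suc k + j))))" by (rule bound)
        also have "\<dots> \<le> C * x powr (-\<nu>) * (\<Prod>j<m. x powr (r ^ j))"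
          using elim C minimal_seq_D_pos[OF b, of k] h_nonneg unfolding x_def
          by (intro mult_mono prod_mono prod_nonneg mult_nonneg_nonneg conjI) auto
        also have "(\<Prod>j<m. x powr (r ^ j)) = x powr (\<Sum>j<m. r ^ j)"
          using elim(3)[rule_format, of "Suc k"] by (subst powr_sum) (auto simp: x_def)
        finally show "1 \<le> C * x powr (- \<nu> + (\<Sum>j<m. r ^ j))"
          by (simp only: powr_add mult.assoc)
      qed
    qed
    moreover have "filterlim (\<lambda>k. real_of_int (h (b (Suc k)))) at_top sequentially"
      using minimal_seq_h_unbounded[OF b] by (subst filterlim_sequentially_Suc)
    ultimately have "0 \<le> - \<nu> + (\<Sum>j<m. r ^ j)"
      using exponent_nonneg[OF inf] by blast
    then show ?case by (simp add: g_def \<nu>_def \<mu>_def r_def)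
  qed
  ultimately have "0 \<le> g 0" by (rule tendsto_lowerbound) auto
  then show ?thesis by (simp add: g_def)
qed

text \<open>Here the measure is y, the height of the last point \<open>b (k + m)\<close>. It is m -
  1 - j growth steps after \<open>b (k + j + 1)\<close>, so the distance of \<open>b (k + j)\<close>
  is at most y to the power \<open>-\<nu> / r ^ (m - 1 - j)\<close>; the product over j produces a
  geometric sum in 1 / r.\<close>

lemma approx_hat_mult_power_sum_le:
  assumes inf: "infinite {k. P k}"
    and bound: "\<And>k. P k \<Longrightarrow> 1 \<le> C * real_of_int (h (b (k + m))) * (\<Prod>j<m. D (b (k + j)))"
    and C: "C \<ge> 0"
    and wh: "approx_hat_exp n h D 1 = ereal wh" and w: "approx_exp n h D 1 = ereal w"
  shows "wh * (\<Sum>j<m. (wh / w) ^ j) \<le> 1"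
proof -
  have pos: "0 < wh" "wh \<le> w"
    using approx_hat_le_exp[of n h D 1] approx_hat_pos wh w by auto
  define g where "g \<epsilon> = 1 - (wh - \<epsilon>) * (\<Sum>j<m. ((wh - \<epsilon>) / (w + \<epsilon>)) ^ j)" for \<epsilon>
  have "(g \<longlongrightarrow> g 0) (at_right 0)"
    unfolding g_def using pos by (intro tendsto_eq_intros refl | simp)+
  moreover have "\<forall>\<^sub>F \<epsilon> in at_right 0. 0 \<le> g \<epsilon>"
    using eventually_at_right_real[OF pos(1)]
  proof eventually_elim
    case (elim \<epsilon>)
    define \<nu> \<mu> r where "\<nu> = wh - \<epsilon>" and "\<mu> = w + \<epsilon>" and "r = \<mu> / \<nu>"
    have \<nu>: "0 < \<nu>" "ereal \<nu> < approx_hat_exp n h D 1" "approx_exp n h D 1 < ereal \<mu>" and r: "r > 0"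
      using elim pos wh w by (auto simp: \<nu>_def \<mu>_def r_def)
    have "\<forall>\<^sub>F k in sequentially. \<forall>j. real_of_int (h (b (k + j))) \<le> of_int (h (b k)) powr (r ^ j)"
      using minimal_seq_growth_iterated[OF b minimal_seq_growth[OF b \<nu>(2,1,3)] r[unfolded r_def]]
      unfolding r_def .
    then have "\<forall>\<^sub>F k in sequentially. (\<forall>j. real_of_int (h (b (k + j))) \<le> of_int (h (b k)) powr (r ^ j))
        \<and> D (b k) \<le> of_int (h (b (Suc k))) powr (-\<nu>) \<and> 1 \<le> real_of_int (h (b k))"
      using minimal_seq_D_upper[OF b \<nu>(2)] minimal_seq_h_ge[OF b, of 1] by eventually_elim blast
    then obtain K where K: "\<And>k j. k \<ge> K \<Longrightarrow> real_of_int (h (b (k + j))) \<le> of_int (h (b k)) powr (r ^ j)"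
        "\<And>k. k \<ge> K \<Longrightarrow> D (b k) \<le> of_int (h (b (Suc k))) powr (-\<nu>)"
        "\<And>k. k \<ge> K \<Longrightarrow> 1 \<le> real_of_int (h (b k))"
      unfolding eventually_sequentially by blast
    have "P k \<longrightarrow> 1 \<le> C * real_of_int (h (b (k + m))) powr (1 - \<nu> * (\<Sum>j<m. (1 / r) ^ j))"
      if k: "k \<ge> K" for k
    proof
      define y where "y = real_of_int (h (b (k + m)))"
      have y: "y \<ge> 1" using K(3)[of "k + m"] k by (simp add: y_def)
      have D: "D (b (k + j)) \<le> y powr (-\<nu> * (1 / r) ^ (m - Suc j))" if j: "j < m" for j
      proof -
        define x s where "x = real_of_int (h (b (Suc (k + j))))" and "s = r ^ (m - Suc j)"
        have s: "s > 0" using r by (simp add: s_def)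
        have x: "x \<ge> 1" using K(3)[of "Suc (k + j)"] k by (simp add: x_def)
        have "y \<le> x powr s"
          using K(1)[of "Suc (k + j)" "m - Suc j"] j k by (simp add: x_def y_def s_def)
        then have "y powr (\<nu> / s) \<le> (x powr s) powr (\<nu> / s)"
          using y \<nu> s by (intro powr_mono2) auto
        then have "y powr (\<nu> / s) \<le> x powr \<nu>" using s by (simp add: powr_powr)
        then have "x powr (-\<nu>) \<le> y powr (-(\<nu> / s))"
          using x y by (simp add: powr_minus le_imp_inverse_le)
        moreover have "D (b (k + j)) \<le> x powr (-\<nu>)"
          using K(2)[of "k + j"] k by (simp add: x_def)
        ultimately show ?thesis by (simp add: s_def power_one_over)
      qed
      assume "P k"
      then have "1 \<le> C * y * (\<Prod>j<m. D (b (k + j)))" unfolding y_def by (rule bound)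
      also have "\<dots> \<le> C * y * (\<Prod>j<m. y powr (-\<nu> * (1 / r) ^ (m - Suc j)))"
        using D C y minimal_seq_D_pos[OF b] by (intro mult_left_mono prod_mono conjI) (auto intro: less_imp_le)
      also have "(\<Prod>j<m. y powr (-\<nu> * (1 / r) ^ (m - Suc j)))
          = y powr (\<Sum>j<m. -\<nu> * (1 / r) ^ (m - Suc j))"
        using y by (simp add: powr_sum)
      also have "(\<Sum>j<m. -\<nu> * (1 / r) ^ (m - Suc j)) = -\<nu> * (\<Sum>j<m. (1 / r) ^ j)"
        by (subst sum.nat_diff_reindex) (simp add: sum_distrib_left sum_negf)
      finally show "1 \<le> C * y powr (1 - \<nu> * (\<Sum>j<m. (1 / r) ^ j))"
        using y by (simp add: powr_diff powr_minus field_simps)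
    qed
    then have "\<forall>\<^sub>F k in sequentially. P k \<longrightarrow>
        1 \<le> C * real_of_int (h (b (k + m))) powr (1 - \<nu> * (\<Sum>j<m. (1 / r) ^ j))"
      unfolding eventually_sequentially by blast
    moreover have "filterlim (\<lambda>k. real_of_int (h (b (k + m)))) at_top sequentially"
      by (intro filterlim_compose[OF minimal_seq_h_unbounded[OF b]] filterlim_add_const_nat_at_top)
    ultimately have "0 \<le> 1 - \<nu> * (\<Sum>j<m. (1 / r) ^ j)"
      using exponent_nonneg[OF inf] by blast
    then show ?case by (simp add: g_def \<nu>_def \<mu>_def r_def)
  qed
  ultimately have "0 \<le> g 0" by (rule tendsto_lowerbound) auto
  then show ?thesis by (simp add: g_def)
qed

section \<open>Linear relations between consecutive minimal points\<close>

text \<open>If \<open>b (Suc k)\<close> were t times \<open>b k\<close>, the strict decrease of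
  \<open>D\<close> would force |t| < 1, while nondecreasing positive heights force |t| to be at
  least 1.\<close>

lemma minimal_seq_pair_indep:
  assumes hk: "h (b k) > 0"
    and rel: "\<And>i. i \<le> n \<Longrightarrow> c * real_of_int (b k i) + d * real_of_int (b (Suc k) i) = 0"
  shows "c = 0 \<and> d = 0"
proof (cases "d = 0")
  case True
  obtain i where "i \<le> n" "b k i \<noteq> 0"
    using minimal_seq_vec[OF b, of k] by (auto simp: nonzero_vec_def)
  with rel[of i] True show ?thesis by simp
next
  case False
  define t where "t = - c / d"
  have "real_of_int (b (Suc k) i) = t * real_of_int (b k i)" if "i \<le> n" for i
    using rel[OF that] False by (simp add: t_def field_simps)
  then have hom: "of_int (h (b (Suc k))) = \<bar>t\<bar> * of_int (h (b k))" "D (b (Suc k)) = \<bar>t\<bar> * D (b k)"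
    using homogeneous[of "b (Suc k)" "b k" t] minimal_seq_vec[OF b] by auto
  have "\<bar>t\<bar> * D (b k) < 1 * D (b k)"
    using minimal_seq_D_less[OF b, of k "Suc k"] hom by simp
  then have "\<bar>t\<bar> < 1" using minimal_seq_D_pos[OF b, of k] by simp
  moreover have "1 * real_of_int (h (b k)) \<le> \<bar>t\<bar> * of_int (h (b k))"
    using minimal_seq_h_le[OF b, of k "Suc k"] hom by simp
  then have "1 \<le> \<bar>t\<bar>" using hk by (subst (asm) mult_le_cancel_right) auto
  ultimately show ?thesis by simp
qed

text \<open>In a relation among three consecutive points the outer coefficients cannot vanish, since
  both consecutive pairs are independent. Solving for the third point then leaves a nonzero
  coefficient \<open>s\<close> at the first.\<close>

lemma minimal_seq_recurrence:
  assumes hk: "h (b k) > 0" and dep: "\<not> lin_indep n 3 (\<lambda>j. b (k + j))"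
  shows "\<exists>s t. s \<noteq> 0 \<and> (\<forall>i\<le>n. real_of_int (b (Suc (Suc k)) i) =
            s * of_int (b k i) + t * of_int (b (Suc k) i))"
proof -
  obtain c :: "nat \<Rightarrow> real" and j where c: "\<And>i. i \<le> n \<Longrightarrow> (\<Sum>j<3. c j * of_int (b (k + j) i)) = 0"
      and j: "j < 3" "c j \<noteq> 0"
    using dep unfolding lin_indep_def by blast
  have c': "c 0 * of_int (b k i) + c 1 * of_int (b (Suc k) i) + c 2 * of_int (b (Suc (Suc k)) i) = 0"
    if "i \<le> n" for i using c[OF that] by (simp add: eval_nat_numeral)
  have "c 2 \<noteq> 0"
  proof
    assume "c 2 = 0"
    with c' have "c 0 = 0 \<and> c 1 = 0" by (intro minimal_seq_pair_indep[OF hk]) auto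
    with \<open>c 2 = 0\<close> j show False by (auto simp: eval_nat_numeral less_Suc_eq)
  qed
  have "c 0 \<noteq> 0"
  proof
    assume "c 0 = 0"
    have "h (b (Suc k)) > 0" using hk minimal_seq_h_le[OF b, of k "Suc k"] by simp
    with c' \<open>c 0 = 0\<close> have "c 1 = 0 \<and> c 2 = 0" by (intro minimal_seq_pair_indep[of "Suc k"]) auto
    with \<open>c 2 \<noteq> 0\<close> show False by simp
  qed
  have "real_of_int (b (Suc (Suc k)) i) = (- c 0 / c 2) * of_int (b k i) + (- c 1 / c 2) * of_int (b (Suc k) i)"
    if "i \<le> n" for i
    using c'[OF that] \<open>c 2 \<noteq> 0\<close> by (simp add: field_simps)
  moreover have "- c 0 / c 2 \<noteq> 0" using \<open>c 2 \<noteq> 0\<close> \<open>c 0 \<noteq> 0\<close> by simp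
  ultimately show ?thesis by blast
qed

text \<open>The recurrence multiplies every 2 by 2 minor of consecutive points by -s with s nonzero,
  so a minor that is nonzero at \<open>K\<close> remains so.\<close>

lemma minimal_seq_eventually_planar:
  assumes fin: "finite {k. lin_indep n 3 (\<lambda>j. b (k + j))}"
  obtains K i j where "i \<le> n" "j \<le> n"
    "\<And>k. k \<ge> K \<Longrightarrow> b k i * b (Suc k) j - b k j * b (Suc k) i \<noteq> 0"
    "\<And>k. k \<ge> K \<Longrightarrow> \<exists>s t. \<forall>l\<le>n. real_of_int (b (Suc (Suc k)) l) =
            s * of_int (b k l) + t * of_int (b (Suc k) l)"
proof -
  have "\<forall>\<^sub>F k in sequentially. \<not> lin_indep n 3 (\<lambda>j. b (k + j))"
    using fin by (simp add: cofinite_eq_sequentially[symmetric] eventually_cofinite)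
  with minimal_seq_h_ge[OF b, of 1]
  have "\<forall>\<^sub>F k in sequentially. h (b k) > 0 \<and> \<not> lin_indep n 3 (\<lambda>j. b (k + j))"
    by eventually_elim auto
  then obtain K where K: "\<And>k. k \<ge> K \<Longrightarrow> h (b k) > 0 \<and> \<not> lin_indep n 3 (\<lambda>j. b (k + j))"
    unfolding eventually_sequentially by blast
  have rec: "\<exists>s t. s \<noteq> 0 \<and> (\<forall>i\<le>n. real_of_int (b (Suc (Suc k)) i) =
            s * of_int (b k i) + t * of_int (b (Suc k) i))" if "k \<ge> K" for k
    using K[OF that] by (intro minimal_seq_recurrence) auto
  obtain i where i: "i \<le> n" "b K i \<noteq> 0"
    using minimal_seq_vec[OF b, of K] by (auto simp: nonzero_vec_def)
  have "\<exists>j\<le>n. b K i * b (Suc K) j - b K j * b (Suc K) i \<noteq> 0"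
  proof (rule ccontr)
    assume "\<not> ?thesis"
    then have "real_of_int (b K i * b (Suc K) j - b K j * b (Suc K) i) = 0" if "j \<le> n" for j
      using that by auto
    \<comment> \<open>If all minors involving coordinate i vanished, these two numbers would be the
      coefficients of a relation between \<open>b K\<close> and \<open>b (Suc K)\<close>.\<close>
    then have "- real_of_int (b (Suc K) i) = 0 \<and> real_of_int (b K i) = 0"
      using K[of K] by (intro minimal_seq_pair_indep[of K]) (auto simp: algebra_simps)
    with i show False by simp
  qed
  then obtain j where j: "j \<le> n" "b K i * b (Suc K) j - b K j * b (Suc K) i \<noteq> 0" by blast
  have "b k i * b (Suc k) j - b k j * b (Suc k) i \<noteq> 0" if "k \<ge> K" for k
    using that
  proof (induction k rule: dec_induct)
    case base
    then show ?case by (rule j)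
  next
    case (step k)
    then obtain s t where st: "s \<noteq> 0" "\<forall>i\<le>n. real_of_int (b (Suc (Suc k)) i) =
            s * of_int (b k i) + t * of_int (b (Suc k) i)" using rec by blast
    have "real_of_int (b (Suc k) i * b (Suc (Suc k)) j - b (Suc k) j * b (Suc (Suc k)) i)
      = - s * real_of_int (b k i * b (Suc k) j - b k j * b (Suc k) i)"
      using st i j by (simp add: algebra_simps)
    also have "\<dots> \<noteq> 0" using st step.IH by (metis mult_eq_0_iff neg_equal_0_iff_equal of_int_eq_0_iff)
    finally show ?case by linarith
  qed
  moreover have "\<exists>s t. \<forall>l\<le>n. real_of_int (b (Suc (Suc k)) l) =
            s * of_int (b k l) + t * of_int (b (Suc k) l)" if "k \<ge> K" for k
    using rec[OF that] by blast
  ultimately show ?thesis using that i j by blast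
qed

end
end

section \<open>Elementary bounds for geometric sums\<close>

text \<open>As r = w / wh is at least 1, the sum is at most 1 + (n - 1) r^(n-1); solve for
  r.\<close>

lemma power_sum_lower_bound:
  fixes wh w :: real
  assumes "n \<ge> 2" "1 \<le> wh" "wh \<le> w" "wh \<le> (\<Sum>j<n. (w / wh) ^ j)"
  shows "wh * ((wh - 1) / (real n - 1)) powr (1 / (real n - 1)) \<le> w"
proof -
  define r where "r = w / wh"
  obtain m where m: "n = Suc m" "m \<ge> 1" using assms(1) by (cases n) auto
  have r: "r \<ge> 1" using assms by (simp add: r_def)
  have "wh \<le> (\<Sum>j<Suc m. r ^ j)" using assms(4) m by (simp add: r_def)
  also have "\<dots> = 1 + (\<Sum>j<m. r ^ Suc j)" by (subst sum.lessThan_Suc_shift) simp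
  also have "\<dots> \<le> 1 + (\<Sum>j<m. r ^ m)"
    using r by (intro add_left_mono sum_mono power_increasing) auto
  finally have "(wh - 1) / real m \<le> r ^ m" using m by (simp add: field_simps)
  then have "((wh - 1) / real m) powr (1 / real m) \<le> (r ^ m) powr (1 / real m)"
    using assms by (intro powr_mono2) auto
  also have "\<dots> = r" using r m by (simp add: powr_realpow[symmetric] powr_powr)
  finally have "wh * ((wh - 1) / real m) powr (1 / real m) \<le> wh * r"
    using assms by (intro mult_left_mono) auto
  then show ?thesis using m assms by (simp add: r_def)
qed

text \<open>As q = wh / w is at most 1, the sum is at least 1 + (n - 1) q^(n-1); wh < 1 permits
  solving for 1 / q.\<close>

lemma mult_power_sum_lower_bound:
  fixes wh w :: real
  assumes "n \<ge> 2" "0 < wh" "wh < 1" "wh \<le> w" "wh * (\<Sum>j<n. (wh / w) ^ j) \<le> 1"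
  shows "wh * ((real n - 1) * wh / (1 - wh)) powr (1 / (real n - 1)) \<le> w"
proof -
  define q where "q = wh / w"
  obtain m where m: "n = Suc m" "m \<ge> 1" using assms(1) by (cases n) auto
  have q: "0 < q" "q \<le> 1" using assms by (auto simp: q_def)
  have "wh * (1 + real m * q ^ m) = wh * (1 + (\<Sum>j<m. q ^ m))" by simp
  also have "\<dots> \<le> wh * (1 + (\<Sum>j<m. q ^ Suc j))"
    using q assms by (intro mult_left_mono add_left_mono sum_mono power_decreasing) auto
  also have "1 + (\<Sum>j<m. q ^ Suc j) = (\<Sum>j<Suc m. q ^ j)" by (subst sum.lessThan_Suc_shift) simp
  also have "wh * \<dots> \<le> 1" using assms(5) m by (simp add: q_def)
  finally have "real m * wh / (1 - wh) \<le> (1 / q) ^ m"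
    using assms q by (simp add: field_simps power_divide)
  then have "(real m * wh / (1 - wh)) powr (1 / real m) \<le> ((1 / q) ^ m) powr (1 / real m)"
    using assms by (intro powr_mono2) auto
  also have "\<dots> = 1 / q" using q m by (simp add: powr_realpow[symmetric] powr_powr)
  finally have "wh * (real m * wh / (1 - wh)) powr (1 / real m) \<le> wh * (1 / q)"
    using assms by (intro mult_left_mono) auto
  then show ?thesis using m assms by (simp add: q_def)
qed

section \<open>Linear forms and simultaneous approximation\<close>

lemma Hgt_le_iff: "Hgt n v \<le> B \<longleftrightarrow> (\<forall>i\<le>n. \<bar>v i\<bar> \<le> B)"
  unfolding Hgt_def by (subst Max_le_iff) auto

lemma Hgt_ge: "i \<le> n \<Longrightarrow> \<bar>v i\<bar> \<le> Hgt n v"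
  using Hgt_le_iff by blast

lemma Hgt_nonneg: "0 \<le> Hgt n v"
  using Hgt_ge[of 0 n v] by simp

lemma real_Hgt: "real_of_int (Hgt n v) = Max ((\<lambda>i. \<bar>real_of_int (v i)\<bar>) ` {0..n})"
  unfolding Hgt_def by (subst mono_Max_commute) (auto simp: mono_def image_image)

lemma Sdist_le_iff: "n \<ge> 1 \<Longrightarrow> Sdist n \<zeta> v \<le> B \<longleftrightarrow> (\<forall>i\<in>{1..n}. \<bar>\<zeta> i * of_int (v 0) - of_int (v i)\<bar> \<le> B)"
  unfolding Sdist_def by (subst Max_le_iff) auto

lemma Sdist_ge: "i \<in> {1..n} \<Longrightarrow> \<bar>\<zeta> i * of_int (v 0) - of_int (v i)\<bar> \<le> Sdist n \<zeta> v"
  unfolding Sdist_def by (intro Max_ge) auto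

lemma Max_abs_mult:
  fixes f :: "nat \<Rightarrow> real"
  assumes "finite A" "A \<noteq> {}"
  shows "Max ((\<lambda>i. \<bar>t\<bar> * f i) ` A) = \<bar>t\<bar> * Max (f ` A)"
  using assms by (subst mono_Max_commute[of "\<lambda>x. \<bar>t\<bar> * x"]) (auto simp: mono_def image_image mult_left_mono)

lemma Hgt_homogeneous:
  assumes "\<And>i. i \<le> n \<Longrightarrow> real_of_int (u i) = t * of_int (v i)"
  shows "real_of_int (Hgt n u) = \<bar>t\<bar> * of_int (Hgt n v)"
proof -
  have "Max ((\<lambda>i. \<bar>real_of_int (u i)\<bar>) ` {0..n}) = Max ((\<lambda>i. \<bar>t\<bar> * \<bar>real_of_int (v i)\<bar>) ` {0..n})"
    using assms by (intro arg_cong[where f = Max] image_cong) (auto simp: abs_mult)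
  then show ?thesis unfolding real_Hgt by (subst (asm) Max_abs_mult) auto
qed

lemma Lform_lincomb:
  assumes "\<And>i. i \<le> n \<Longrightarrow> real_of_int (u i) = s * of_int (v i) + t * of_int (w i)"
  shows "Lform n \<zeta> u = s * Lform n \<zeta> v + t * Lform n \<zeta> w"
  using assms by (simp add: Lform_def algebra_simps sum.distrib sum_distrib_left)

lemma Lform_homogeneous:
  assumes "\<And>i. i \<le> n \<Longrightarrow> real_of_int (u i) = t * of_int (v i)"
  shows "Lform n \<zeta> u = t * Lform n \<zeta> v"
  using Lform_lincomb[of n u t v 0 v] assms by simp

lemma Sdist_homogeneous:
  assumes "n \<ge> 1" "\<And>i. i \<le> n \<Longrightarrow> real_of_int (u i) = t * of_int (v i)"
  shows "Sdist n \<zeta> u = \<bar>t\<bar> * Sdist n \<zeta> v"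
proof -
  have "\<bar>\<zeta> i * of_int (u 0) - of_int (u i)\<bar> = \<bar>t\<bar> * \<bar>\<zeta> i * of_int (v 0) - of_int (v i)\<bar>" if "i \<in> {1..n}" for i
    using that by (simp add: assms(2) abs_mult[symmetric] algebra_simps)
  then have "Sdist n \<zeta> u = Max ((\<lambda>i. \<bar>t\<bar> * \<bar>\<zeta> i * of_int (v 0) - of_int (v i)\<bar>) ` {1..n})"
    unfolding Sdist_def by (intro arg_cong[where f = Max] image_cong) auto
  then show ?thesis unfolding Sdist_def using assms(1) by (subst (asm) Max_abs_mult) auto
qed

lemma Lform_eq_0D:
  assumes "Q_lin_indep_1 n \<zeta>" "Lform n \<zeta> v = 0" "i \<le> n"
  shows "v i = 0"
proof -
  have "of_rat (of_int (v 0)) + (\<Sum>i=1..n. of_rat (of_int (v i)) * \<zeta> i) = 0"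
    using assms(2) by (simp add: Lform_def mult.commute)
  then have "\<forall>i\<le>n. (of_int (v i) :: rat) = 0"
    using assms(1) unfolding Q_lin_indep_1_def by (elim allE[of _ "\<lambda>i. of_int (v i)"]) blast
  then show ?thesis using assms(3) by simp
qed

lemma finite_int_vec_bounded: "finite {v. int_vec n v \<and> (\<forall>i\<le>n. \<bar>v i\<bar> \<le> B)}"
proof -
  have "{v. int_vec n v \<and> (\<forall>i\<le>n. \<bar>v i\<bar> \<le> B)} \<subseteq>
      {v. \<forall>i. (i \<in> {0..n} \<longrightarrow> v i \<in> {-B..B}) \<and> (i \<notin> {0..n} \<longrightarrow> v i = 0)}"
    by (auto simp: int_vec_def abs_le_iff)
  then show ?thesis
    by (rule finite_subset) (intro finite_set_of_finite_funs finite_atLeastAtMost finite_atLeastAtMost_int)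
qed

text \<open>The triangle inequality, with one constant for all vectors: a bounded first coordinate
  and a bounded distance confine a vector to a box, which gives finiteness.\<close>

lemma Sdist_bound:
  "\<exists>c\<ge>0. \<forall>v. \<forall>i\<in>{1..n}. \<bar>real_of_int (v i)\<bar> \<le> c * \<bar>of_int (v 0)\<bar> + Sdist n \<zeta> v"
proof (intro exI[of _ "\<Sum>i=1..n. \<bar>\<zeta> i\<bar>"] conjI allI ballI)
  fix v i assume i: "i \<in> {1..n}"
  have "\<bar>real_of_int (v i)\<bar> \<le> \<bar>\<zeta> i\<bar> * \<bar>of_int (v 0)\<bar> + \<bar>\<zeta> i * of_int (v 0) - of_int (v i)\<bar>"
    by (simp add: abs_mult[symmetric])
  also have "\<dots> \<le> (\<Sum>i=1..n. \<bar>\<zeta> i\<bar>) * \<bar>of_int (v 0)\<bar> + Sdist n \<zeta> v"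
    using i by (intro add_mono mult_right_mono Sdist_ge member_le_sum) auto
  finally show "\<bar>real_of_int (v i)\<bar> \<le> (\<Sum>i=1..n. \<bar>\<zeta> i\<bar>) * \<bar>of_int (v 0)\<bar> + Sdist n \<zeta> v" .
qed (simp add: sum_nonneg)

section \<open>Dirichlet-type solvability of the systems by one vector\<close>

lemma approx_sys_1I:
  assumes "int_vec n v" "nonzero_vec n v" "of_int (h v) \<le> X" "D v \<le> X powr (-\<nu>)"
  shows "approx_sys n h D 1 X \<nu>"
  unfolding approx_sys_def using assms
  by (intro exI[of _ "\<lambda>_. v"]) (auto simp: lin_indep_1 simp del: One_nat_def)

text \<open>Pigeonhole principle on the fractional parts of \<open>\<Sum> \<zeta>\<^sub>i y\<^sub>i\<close> for \<open>0 \<le> y\<^sub>i \<le> N\<close>.\<close>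

lemma Dirichlet_linear_form:
  fixes \<zeta> :: "nat \<Rightarrow> real"
  assumes N: "N > 0" and n: "n \<ge> 1"
  shows "\<exists>v. int_vec n v \<and> nonzero_vec n v \<and> (\<forall>i\<in>{1..n}. \<bar>v i\<bar> \<le> int N) \<and>
             \<bar>Lform n \<zeta> v\<bar> < 1 / real N ^ n"
proof -
  define M where "M = N ^ n"
  have M: "M > 0" using N by (simp add: M_def)
  define S where "S y = (\<Sum>i=1..n. \<zeta> i * real (y i))" for y :: "nat \<Rightarrow> nat"
  define F where "F y = nat \<lfloor>frac (S y) * real M\<rfloor>" for y
  define Y where "Y = (\<Pi>\<^sub>E i\<in>{1..n}. {0..N})"
  have F: "F y < M" for y
  proof -
    have "frac (S y) * real M < 1 * real M"
      using M frac_lt_1 by (intro mult_strict_right_mono) auto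
    then have "\<lfloor>frac (S y) * real M\<rfloor> < int M" by linarith
    then show ?thesis using M by (auto simp: F_def)
  qed
  have "card Y = (N + 1) ^ n" by (simp add: Y_def card_PiE)
  also have "\<dots> > M" using n by (auto simp: M_def intro!: power_strict_mono)
  finally have cardY: "card Y > M" .
  have "\<not> inj_on F Y"
  proof
    assume "inj_on F Y"
    then have "card Y \<le> card {..<M}" using F by (intro card_inj_on_le) auto
    with cardY show False by simp
  qed
  then obtain y z where yz: "y \<in> Y" "z \<in> Y" "y \<noteq> z" "F y = F z"
    by (auto simp: inj_on_def)
  \<comment> \<open>Coordinate 0 removes the integer parts, so the form at \<open>v\<close> is
    exactly the difference of the two fractional parts.\<close>
  define v where "v i = (if i = 0 then \<lfloor>S z\<rfloor> - \<lfloor>S y\<rfloor> else if i \<le> n then int (y i) - int (z i) else 0)" for i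
  have "(\<Sum>i=1..n. \<zeta> i * real_of_int (v i)) = S y - S z"
    unfolding S_def sum_subtractf[symmetric] by (intro sum.cong) (auto simp: v_def algebra_simps)
  then have L: "Lform n \<zeta> v = frac (S y) - frac (S z)"
    by (simp add: Lform_def v_def frac_def)
  have "\<bar>frac (S y) * real M - frac (S z) * real M\<bar> < 1"
  proof -
    have "\<lfloor>frac (S y) * real M\<rfloor> = \<lfloor>frac (S z) * real M\<rfloor>"
      using yz(4) by (simp add: F_def eq_nat_nat_iff)
    then show ?thesis by linarith
  qed
  then have "\<bar>Lform n \<zeta> v\<bar> * real M < 1"
    by (simp add: L abs_mult left_diff_distrib[symmetric])
  then have "\<bar>Lform n \<zeta> v\<bar> < 1 / real N ^ n"
    using M by (simp add: M_def field_simps)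
  moreover have "\<forall>i\<in>{1..n}. \<bar>v i\<bar> \<le> int N"
  proof
    fix i assume "i \<in> {1..n}"
    then have "y i \<le> N" "z i \<le> N" "v i = int (y i) - int (z i)"
      using yz by (auto simp: v_def Y_def)
    then show "\<bar>v i\<bar> \<le> int N" by linarith
  qed
  moreover have "nonzero_vec n v"
  proof -
    obtain i where "y i \<noteq> z i" using yz(3) by blast
    moreover have "i \<in> {1..n}"
      using calculation yz PiE_arb[of y "{1..n}" _ i] PiE_arb[of z "{1..n}" _ i]
      by (auto simp: Y_def)
    ultimately show ?thesis by (auto simp: nonzero_vec_def v_def intro!: exI[of _ i])
  qed
  ultimately show ?thesis by (intro exI[of _ v]) (auto simp: int_vec_def v_def)
qed

text \<open>Coordinates up to N make the form at most N^(-n), hence at most N^(-2), at a height of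
  order N. The exponent 3/2 is below 2 to absorb constants and above 1, as
  \<open>linear_form_three_independent\<close> requires.\<close>

lemma linear_form_sys:
  fixes \<zeta> :: "nat \<Rightarrow> real"
  assumes "n \<ge> 2"
  shows "\<exists>X0. \<forall>X\<ge>X0. approx_sys n (Hgt n) (\<lambda>v. \<bar>Lform n \<zeta> v\<bar>) 1 X (3/2)"
proof -
  \<comment> \<open>If the other coordinates are at most N and the form at most 1 in absolute value,
    then |v 0| is at most C N; the summand 1 pays for the form. Hence N is the integer part of X /
    C.\<close>
  define C where "C = (\<Sum>i=1..n. \<bar>\<zeta> i\<bar>) + 1"
  have C: "C \<ge> 1" by (simp add: C_def sum_nonneg)
  have "\<forall>\<^sub>F X in at_top. 1 / (X / C - 1)\<^sup>2 \<le> X powr (-(3/2))"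
    using C by real_asymp
  then obtain X1 where X1: "\<And>X. X \<ge> X1 \<Longrightarrow> 1 / (X / C - 1)\<^sup>2 \<le> X powr (-(3/2))"
    unfolding eventually_at_top_linorder by blast
  have "approx_sys n (Hgt n) (\<lambda>v. \<bar>Lform n \<zeta> v\<bar>) 1 X (3/2)" if X: "X \<ge> max X1 (2 * C)" for X
  proof -
    define N where "N = nat \<lfloor>X / C\<rfloor>"
    have "X / C \<ge> 2" using X C by (simp add: field_simps)
    then have N: "N > 0" "real N \<le> X / C" "X / C - 1 \<le> real N" "X / C - 1 \<ge> 1"
      by (auto simp: N_def)
    obtain v where v: "int_vec n v" "nonzero_vec n v" "\<And>i. i \<in> {1..n} \<Longrightarrow> \<bar>v i\<bar> \<le> int N"
        "\<bar>Lform n \<zeta> v\<bar> < 1 / real N ^ n"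
      using Dirichlet_linear_form[OF N(1), of n \<zeta>] assms by auto
    have N1: "1 \<le> real N" using N by simp
    have L: "\<bar>Lform n \<zeta> v\<bar> \<le> 1 / (real N)\<^sup>2"
    proof -
      have "(real N)\<^sup>2 \<le> real N ^ n" using N1 assms by (intro power_increasing) auto
      then have "1 / real N ^ n \<le> 1 / (real N)\<^sup>2" using N1 by (intro divide_left_mono) auto
      then show ?thesis using v(4) by simp
    qed
    have "real_of_int (Hgt n v) \<le> X"
    proof -
      have NX: "C * real N \<le> X" using N C by (simp add: field_simps)
      have "\<bar>real_of_int (v i)\<bar> \<le> X" if "i \<le> n" for i
      proof (cases "i = 0")
        case False
        then have "\<bar>v i\<bar> \<le> int N" using v(3) that by simp
        then have "\<bar>real_of_int (v i)\<bar> \<le> real N" by linarith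
        also have "\<dots> \<le> C * real N" using C by (simp add: mult_right_mono[of 1 C "real N", simplified])
        finally show ?thesis using NX by simp
      next
        case True
        have "\<bar>real_of_int (v 0)\<bar> \<le> \<bar>Lform n \<zeta> v\<bar> + \<bar>\<Sum>i=1..n. \<zeta> i * real_of_int (v i)\<bar>"
          by (simp add: Lform_def)
        also have "\<dots> \<le> 1 + (\<Sum>i=1..n. \<bar>\<zeta> i\<bar> * real N)"
        proof (intro add_mono)
          have "1 / (real N)\<^sup>2 \<le> 1" using N1 by simp
          then show "\<bar>Lform n \<zeta> v\<bar> \<le> 1" using L by simp
          have "\<bar>\<Sum>i=1..n. \<zeta> i * real_of_int (v i)\<bar> \<le> (\<Sum>i=1..n. \<bar>\<zeta> i * real_of_int (v i)\<bar>)"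
            by (rule sum_abs)
          also have "\<dots> \<le> (\<Sum>i=1..n. \<bar>\<zeta> i\<bar> * real N)"
          proof (rule sum_mono)
            fix i assume "i \<in> {1..n}"
            then have "\<bar>v i\<bar> \<le> int N" by (rule v(3))
            then have "\<bar>real_of_int (v i)\<bar> \<le> real N" by linarith
            then show "\<bar>\<zeta> i * real_of_int (v i)\<bar> \<le> \<bar>\<zeta> i\<bar> * real N"
              by (simp add: abs_mult mult_left_mono)
          qed
          finally show "\<bar>\<Sum>i=1..n. \<zeta> i * real_of_int (v i)\<bar> \<le> (\<Sum>i=1..n. \<bar>\<zeta> i\<bar> * real N)" .
        qed
        also have "\<dots> \<le> real N + (\<Sum>i=1..n. \<bar>\<zeta> i\<bar> * real N)" using N1 by simp
        also have "\<dots> = C * real N" by (simp add: C_def sum_distrib_right distrib_right)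
        finally show ?thesis using NX True by simp
      qed
      then have "Hgt n v \<le> \<lfloor>X\<rfloor>"
        unfolding Hgt_le_iff by (auto simp: le_floor_iff)
      then show ?thesis by (simp add: le_floor_iff)
    qed
    moreover have "\<bar>Lform n \<zeta> v\<bar> \<le> X powr (-(3/2))"
    proof -
      have "1 / (real N)\<^sup>2 \<le> 1 / (X / C - 1)\<^sup>2"
        using N by (intro divide_left_mono power_mono mult_pos_pos zero_less_power) auto
      also have "\<dots> \<le> X powr (-(3/2))" using X by (intro X1) simp
      finally show ?thesis using L by simp
    qed
    ultimately show ?thesis using v by (intro approx_sys_1I) auto
  qed
  then show ?thesis by blast
qed

text \<open>With N the integer part of X^(1/n), Dirichlet's theorem gives a denominator at most N^n,
  hence at most X. Half of the exponent 1/n is given up to absorb the rounding.\<close>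

lemma simultaneous_sys:
  fixes \<zeta> :: "nat \<Rightarrow> real"
  assumes "n \<ge> 1"
  shows "\<exists>\<alpha>>0. \<exists>X0. \<forall>X\<ge>X0. approx_sys n (\<lambda>v. \<bar>v 0\<bar>) (Sdist n \<zeta>) 1 X \<alpha>"
proof -
  define a where "a = 1 / real n"
  have a: "a > 0" using assms by (simp add: a_def)
  have "\<forall>\<^sub>F X in at_top. 1 / (X powr a - 1) \<le> X powr (-(a/2)) \<and> X powr a \<ge> 2 \<and> X \<ge> 1"
    using a by (intro eventually_conj; real_asymp)
  then obtain X1 where X1: "\<And>X. X \<ge> X1 \<Longrightarrow>
      1 / (X powr a - 1) \<le> X powr (-(a/2)) \<and> X powr a \<ge> 2 \<and> X \<ge> 1"
    unfolding eventually_at_top_linorder by blast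
  have "approx_sys n (\<lambda>v. \<bar>v 0\<bar>) (Sdist n \<zeta>) 1 X (a/2)" if "X \<ge> X1" for X
  proof -
    have X: "1 / (X powr a - 1) \<le> X powr (-(a/2))" "X powr a \<ge> 2" "X \<ge> 1" using X1[OF that] by auto
    define N where "N = nat \<lfloor>X powr a\<rfloor>"
    have N: "N > 0" "real N \<le> X powr a" "X powr a - 1 \<le> real N" using X by (auto simp: N_def)
    obtain q p where q: "0 < q" "q \<le> int (N ^ n)"
        "\<And>i. i < n \<Longrightarrow> \<bar>of_int q * \<zeta> (Suc i) - of_int (p i)\<bar> < 1 / real N"
      using Dirichlet_approx_simult[OF N(1), of n "\<lambda>i. \<zeta> (Suc i)"] by blast
    define v where "v i = (if i = 0 then q else if i \<le> n then p (i - 1) else 0)" for i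
    have "real_of_int \<bar>v 0\<bar> \<le> real N ^ n"
    proof -
      have "real_of_int q \<le> real_of_int (int (N ^ n))" using q(2) by (simp only: of_int_le_iff)
      then show ?thesis using q(1) by (simp add: v_def)
    qed
    also have "\<dots> \<le> (X powr a) ^ n" using N by (intro power_mono) auto
    also have "\<dots> = X" using X assms by (simp add: powr_realpow[symmetric] powr_powr a_def)
    finally have vX: "real_of_int \<bar>v 0\<bar> \<le> X" .
    have "Sdist n \<zeta> v \<le> 1 / real N"
      unfolding Sdist_le_iff[OF assms]
    proof
      fix i assume "i \<in> {1..n}"
      then show "\<bar>\<zeta> i * of_int (v 0) - of_int (v i)\<bar> \<le> 1 / real N"
        using less_imp_le[OF q(3)[of "i - 1"]] by (auto simp: v_def mult.commute)
    qed
    also have "\<dots> \<le> 1 / (X powr a - 1)" using N X by (intro divide_left_mono) auto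
    also have "\<dots> \<le> X powr (-(a/2))" by (rule X)
    finally show ?thesis
      using vX q by (intro approx_sys_1I[of n v]) (auto simp: int_vec_def nonzero_vec_def v_def)
  qed
  then show ?thesis using a by (intro exI[of _ "a/2"]) auto
qed

text \<open>Independence over the rationals enters through positivity: the form vanishes at no
  nonzero integer vector.\<close>

lemma linear_form_approximation:
  assumes n: "n \<ge> 2" and indep: "Q_lin_indep_1 n \<zeta>"
  shows "approximation n (Hgt n) (\<lambda>v. \<bar>Lform n \<zeta> v\<bar>)"
proof
  show "0 \<le> Hgt n v" for v by (rule Hgt_nonneg)
  show "0 < \<bar>Lform n \<zeta> v\<bar>" if "nonzero_vec n v" for v
    using that Lform_eq_0D[OF indep] by (auto simp: nonzero_vec_def)
  show "finite {v. int_vec n v \<and> Hgt n v \<le> B \<and> \<bar>Lform n \<zeta> v\<bar> \<le> C}" for B C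
    by (rule finite_subset[OF _ finite_int_vec_bounded[of n B]]) (auto simp: Hgt_le_iff)
  show "of_int (Hgt n u) = \<bar>t\<bar> * of_int (Hgt n v) \<and> \<bar>Lform n \<zeta> u\<bar> = \<bar>t\<bar> * \<bar>Lform n \<zeta> v\<bar>"
    if "\<And>i. i \<le> n \<Longrightarrow> real_of_int (u i) = t * of_int (v i)" for u v t
    using Hgt_homogeneous[of n u t v] Lform_homogeneous[of n u t v \<zeta>] that by (simp add: abs_mult)
  show "\<exists>\<alpha>>0. \<exists>X0. \<forall>X\<ge>X0. approx_sys n (Hgt n) (\<lambda>v. \<bar>Lform n \<zeta> v\<bar>) 1 X \<alpha>"
    using linear_form_sys[OF n, of \<zeta>] by (intro exI[of _ "3/2"]) auto
qed

lemma Sdist_nonneg: "n \<ge> 1 \<Longrightarrow> 0 \<le> Sdist n \<zeta> v"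
  using Sdist_ge[of 1 n \<zeta> v] by (auto intro: order_trans[OF abs_ge_zero])

lemma simultaneous_approximation:
  assumes n: "n \<ge> 1" and indep: "Q_lin_indep_1 n \<zeta>"
  shows "approximation n (\<lambda>v. \<bar>v 0\<bar>) (Sdist n \<zeta>)"
proof
  show "0 \<le> \<bar>v 0\<bar>" for v :: "nat \<Rightarrow> int" by simp
  show "0 < Sdist n \<zeta> v" if v: "int_vec n v" "nonzero_vec n v" for v
  proof (rule ccontr)
    assume "\<not> 0 < Sdist n \<zeta> v"
    then have eq: "\<zeta> i * of_int (v 0) = of_int (v i)" if "i \<in> {1..n}" for i
      using Sdist_ge[OF that, of \<zeta> v] by (simp add: abs_le_iff)
    \<comment> \<open>Distance 0 gives \<open>\<zeta> 1 * v 0 = v 1\<close>, an integer relation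
      between 1 and \<open>\<zeta> 1\<close>. Independence forces \<open>v 0 = 0\<close>, and then
      all coordinates vanish.\<close>
    define c :: "nat \<Rightarrow> int" where "c i = (if i = 0 then v 1 else if i = 1 then - v 0 else 0)" for i
    have "(\<Sum>i=1..n. \<zeta> i * real_of_int (c i)) = (\<Sum>i\<in>{1}. \<zeta> i * real_of_int (c i))"
      using n by (intro sum.mono_neutral_right) (auto simp: c_def)
    then have "Lform n \<zeta> c = 0" using eq[of 1] n by (simp add: Lform_def c_def)
    then have "c 1 = 0" using Lform_eq_0D[OF indep] n by blast
    then have "v 0 = 0" by (simp add: c_def)
    then have "v i = 0" if "i \<le> n" for i using eq[of i] that by (cases "i = 0") auto
    then show False using v by (auto simp: nonzero_vec_def)
  qed
  show "finite {v. int_vec n v \<and> \<bar>v 0\<bar> \<le> B \<and> Sdist n \<zeta> v \<le> C}" for B C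
  proof -
    obtain c where c: "c \<ge> 0"
        "\<And>v i. i \<in> {1..n} \<Longrightarrow> \<bar>real_of_int (v i)\<bar> \<le> c * \<bar>of_int (v 0)\<bar> + Sdist n \<zeta> v"
      using Sdist_bound by metis
    have "\<bar>v i\<bar> \<le> max B \<lceil>c * of_int B + C\<rceil>"
      if v: "\<bar>v 0\<bar> \<le> B" "Sdist n \<zeta> v \<le> C" and i: "i \<le> n" for v i
    proof (cases "i = 0")
      case False
      then have "\<bar>real_of_int (v i)\<bar> \<le> c * \<bar>of_int (v 0)\<bar> + Sdist n \<zeta> v" using c(2) i by simp
      also have "\<dots> \<le> c * of_int B + C"
        using v c(1) by (intro add_mono mult_left_mono) (auto simp flip: of_int_abs)
      finally show ?thesis by linarith
    qed (use v in auto)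
    then show ?thesis
      by (intro finite_subset[OF _ finite_int_vec_bounded[of n "max B \<lceil>c * of_int B + C\<rceil>"]]) auto
  qed
  show "of_int \<bar>u 0\<bar> = \<bar>t\<bar> * of_int \<bar>v 0\<bar> \<and> Sdist n \<zeta> u = \<bar>t\<bar> * Sdist n \<zeta> v"
    if "\<And>i. i \<le> n \<Longrightarrow> real_of_int (u i) = t * of_int (v i)" for u v t
    using Sdist_homogeneous[OF n, of u t v \<zeta>] that by (simp add: abs_mult)
  show "\<exists>\<alpha>>0. \<exists>X0. \<forall>X\<ge>X0. approx_sys n (\<lambda>v. \<bar>v 0\<bar>) (Sdist n \<zeta>) 1 X \<alpha>"
    by (rule simultaneous_sys[OF n])
qed

lemma linear_form_hat_ge:
  assumes "n \<ge> 2"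
  shows "ereal (3/2) \<le> approx_hat_exp n (Hgt n) (\<lambda>v. \<bar>Lform n \<zeta> v\<bar>) 1"
  using linear_form_sys[OF assms, of \<zeta>] le_approx_hatI by blast

text \<open>If the minimal points were eventually confined to a plane, then \<open>|L(v\<^sub>k)| H(v\<^sub>k\<^sub>+\<^sub>1)\<close> would be
  bounded below: the vector \<open>L(v\<^sub>k) v\<^sub>k\<^sub>+\<^sub>1 - L(v\<^sub>k\<^sub>+\<^sub>1) v\<^sub>k\<close> is then a fixed vector times a nonzero
  integer minor of \<open>v\<^sub>k, v\<^sub>k\<^sub>+\<^sub>1\<close>.\<close>

lemma linear_form_three_independent:
  assumes n: "n \<ge> 2" and indep: "Q_lin_indep_1 n \<zeta>"
    and b: "minimal_seq n (Hgt n) (\<lambda>v. \<bar>Lform n \<zeta> v\<bar>) b"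
  shows "infinite {k. lin_indep n 3 (\<lambda>j. b (k + j))}"
proof
  interpret approximation n "Hgt n" "\<lambda>v. \<bar>Lform n \<zeta> v\<bar>"
    by (rule linear_form_approximation[OF n indep])
  assume "finite {k. lin_indep n 3 (\<lambda>j. b (k + j))}"
  then obtain K i j where ij: "i \<le> n" "j \<le> n"
    and minor: "\<And>k. k \<ge> K \<Longrightarrow> b k i * b (Suc k) j - b k j * b (Suc k) i \<noteq> 0"
    and rec: "\<And>k. k \<ge> K \<Longrightarrow> \<exists>s t. \<forall>l\<le>n. real_of_int (b (Suc (Suc k)) l) =
            s * of_int (b k l) + t * of_int (b (Suc k) l)"
    by (rule minimal_seq_eventually_planar[OF b]) blast
  define m where "m k = real_of_int (b k i * b (Suc k) j - b k j * b (Suc k) i)" for k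
  define z where "z k l = Lform n \<zeta> (b k) * of_int (b (Suc k) l) - Lform n \<zeta> (b (Suc k)) * of_int (b k l)" for k l
  have m: "\<bar>m k\<bar> \<ge> 1" if "k \<ge> K" for k using minor[OF that] unfolding m_def by linarith
  have LK: "Lform n \<zeta> (b K) \<noteq> 0" using minimal_seq_D_pos[OF b, of K] by simp
  have "\<exists>l\<le>n. z K l \<noteq> 0"
  proof (rule ccontr)
    assume "\<not> ?thesis"
    then have "z K i = 0" "z K j = 0" using ij by auto
    \<comment> \<open>This combination of coordinates i and j of \<open>z K\<close> cancels the
      terms with \<open>Lform n \<zeta> (b (Suc K))\<close>.\<close>
    moreover have "Lform n \<zeta> (b K) * m K = of_int (b K i) * z K j - of_int (b K j) * z K i"
      by (simp add: m_def z_def algebra_simps)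
    ultimately show False using LK m[of K] by auto
  qed
  then obtain l where l: "l \<le> n" "z K l \<noteq> 0" by blast
  \<comment> \<open>Both \<open>z k l\<close> and \<open>m k\<close> are alternating in the pair
    \<open>b k\<close>, \<open>b (Suc k)\<close>, so the recurrence multiplies each by -s and their
    ratio stays constant.\<close>
  have inv: "z k l * m K = z K l * m k" if "k \<ge> K" for k
    using that
  proof (induction k rule: dec_induct)
    case (step k)
    obtain s t where st: "\<forall>l\<le>n. real_of_int (b (Suc (Suc k)) l) =
            s * of_int (b k l) + t * of_int (b (Suc k) l)" using rec step by blast
    then have "Lform n \<zeta> (b (Suc (Suc k))) = s * Lform n \<zeta> (b k) + t * Lform n \<zeta> (b (Suc k))"
      by (intro Lform_lincomb) auto
    then have "z (Suc k) l = - s * z k l" using st l by (simp add: z_def algebra_simps)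
    moreover have "m (Suc k) = - s * m k" using st ij by (simp add: m_def algebra_simps)
    ultimately show ?case using step.IH by simp
  qed simp
  define c where "c = \<bar>z K l\<bar> / \<bar>m K\<bar>"
  have c: "c > 0" using l m[of K] by (simp add: c_def)
  have lower: "c \<le> 2 * (\<bar>Lform n \<zeta> (b k)\<bar> * of_int (Hgt n (b (Suc k))))" if k: "k \<ge> K" for k
  proof -
    have "c \<le> c * \<bar>m k\<bar>" using c m[OF k] by simp
    also have "\<dots> = \<bar>z k l\<bar>"
      using arg_cong[OF inv[OF k], of abs] m[of K] by (simp add: c_def abs_mult field_simps)
    also have "\<dots> \<le> \<bar>Lform n \<zeta> (b k)\<bar> * \<bar>of_int (b (Suc k) l)\<bar> + \<bar>Lform n \<zeta> (b (Suc k))\<bar> * \<bar>of_int (b k l)\<bar>"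
      unfolding z_def by (simp flip: abs_mult)
    also have "\<dots> \<le> \<bar>Lform n \<zeta> (b k)\<bar> * of_int (Hgt n (b (Suc k))) + \<bar>Lform n \<zeta> (b k)\<bar> * of_int (Hgt n (b (Suc k)))"
    proof (intro add_mono mult_mono)
      show "\<bar>real_of_int (b (Suc k) l)\<bar> \<le> of_int (Hgt n (b (Suc k)))"
        using Hgt_ge[OF l(1), of "b (Suc k)"] by linarith
      show "\<bar>real_of_int (b k l)\<bar> \<le> of_int (Hgt n (b (Suc k)))"
        using Hgt_ge[OF l(1), of "b k"] minimal_seq_h_le[OF b, of k "Suc k"] by linarith
      show "\<bar>Lform n \<zeta> (b (Suc k))\<bar> \<le> \<bar>Lform n \<zeta> (b k)\<bar>"
        using minimal_seq_D_le[OF b, of k "Suc k"] by simp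
    qed (use Hgt_nonneg in auto)
    finally show ?thesis by simp
  qed
  \<comment> \<open>An exponent strictly between 1 and 3/2: it makes the product bounded below in
    \<open>lower\<close> at most a negative power of the height, which tends to 0.\<close>
  have "ereal (5/4) < ereal (3/2)" by simp
  from this linear_form_hat_ge[OF n]
  have "ereal (5/4) < approx_hat_exp n (Hgt n) (\<lambda>v. \<bar>Lform n \<zeta> v\<bar>) 1" by (rule less_le_trans)
  from minimal_seq_D_upper[OF b this] minimal_seq_h_ge[OF b, of 1] eventually_ge_at_top[of K]
  have "\<forall>\<^sub>F k in sequentially. True \<longrightarrow> 1 \<le> 2 / c * real_of_int (Hgt n (b (Suc k))) powr (- (1/4))"
  proof eventually_elim
    case (elim k)
    define x where "x = real_of_int (Hgt n (b (Suc k)))"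
    have x: "x \<ge> 1" using elim(2) minimal_seq_h_le[OF b, of k "Suc k"] by (simp add: x_def)
    have "c \<le> 2 * (\<bar>Lform n \<zeta> (b k)\<bar> * x)" unfolding x_def by (rule lower[OF elim(3)])
    also have "\<dots> \<le> 2 * (x powr (-(5/4)) * x)"
      using elim(1) x by (intro mult_left_mono mult_right_mono) (auto simp: x_def)
    also have "x powr (-(5/4)) * x = x powr (-(5/4) + 1)" using x by (simp only: powr_add powr_one)
    finally show ?case using c by (simp add: x_def field_simps)
  qed
  moreover have "filterlim (\<lambda>k. real_of_int (Hgt n (b (Suc k)))) at_top sequentially"
    using minimal_seq_h_unbounded[OF b] by (subst filterlim_sequentially_Suc)
  moreover have "infinite {k::nat. True}" by simp
  ultimately have "0 \<le> - (1/4 :: real)" using exponent_nonneg by blast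
  then show False by simp
qed

text \<open>If the minimal points were eventually confined to a plane, then this rational plane would
  contain their limiting direction \<open>(1, \<zeta>\<^sub>1, \<dots>, \<zeta>\<^sub>n)\<close>.\<close>

lemma simultaneous_three_independent:
  assumes n: "n \<ge> 2" and indep: "Q_lin_indep_1 n \<zeta>"
    and b: "minimal_seq n (\<lambda>v. \<bar>v 0\<bar>) (Sdist n \<zeta>) b"
  shows "infinite {k. lin_indep n 3 (\<lambda>j. b (k + j))}"
proof
  interpret approximation n "\<lambda>v. \<bar>v 0\<bar>" "Sdist n \<zeta>"
    using n by (intro simultaneous_approximation[OF _ indep]) simp
  assume "finite {k. lin_indep n 3 (\<lambda>j. b (k + j))}"
  then obtain K i j where ij: "i \<le> n" "j \<le> n"
    and minor: "\<And>k. k \<ge> K \<Longrightarrow> b k i * b (Suc k) j - b k j * b (Suc k) i \<noteq> 0"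
    and rec: "\<And>k. k \<ge> K \<Longrightarrow> \<exists>s t. \<forall>l\<le>n. real_of_int (b (Suc (Suc k)) l) =
            s * of_int (b k l) + t * of_int (b (Suc k) l)"
    by (rule minimal_seq_eventually_planar[OF b]) blast
  have "i \<noteq> j" using minor[of K] by auto
  have "card {i, j} < card {0..n}" using n by (simp add: card_insert_if)
  then have "\<not> {0..n} \<subseteq> {i, j}" using card_mono[of "{i, j}" "{0..n}"] by auto
  then obtain l where "l \<in> {0..n}" "l \<notin> {i, j}" by blast
  then have l: "l \<le> n" "l \<noteq> i" "l \<noteq> j" by auto
  define M where "M p q = b K p * b (Suc K) q - b K q * b (Suc K) p" for p q
  \<comment> \<open>The cross product of \<open>b K\<close> and \<open>b (Suc K)\<close> in the
    coordinates i, j, l, where l exists because n is at least 2. It is orthogonal to both points,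
    hence by the recurrence to all later ones.\<close>
  define c where "c = (\<lambda>_. 0) (i := M j l, j := M l i, l := M i j)"
  define S where "S k = (\<Sum>a\<in>{0..n}. real_of_int (c a) * of_int (b k a))" for k
  have S: "S k = of_int (M j l) * of_int (b k i) + of_int (M l i) * of_int (b k j) + of_int (M i j) * of_int (b k l)" for k
  proof -
    have "S k = (\<Sum>a\<in>{i, j, l}. real_of_int (c a) * of_int (b k a))"
      unfolding S_def using ij l by (intro sum.mono_neutral_right) (auto simp: c_def)
    then show ?thesis using l \<open>i \<noteq> j\<close> by (simp add: c_def)
  qed
  have S0: "S k = 0 \<and> S (Suc k) = 0" if "k \<ge> K" for k
    using that
  proof (induction k rule: dec_induct)
    case base
    then show ?case by (simp add: S M_def algebra_simps)
  next
    case (step k)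
    obtain s t where st: "\<forall>l\<le>n. real_of_int (b (Suc (Suc k)) l) =
            s * of_int (b k l) + t * of_int (b (Suc k) l)" using rec step by blast
    then have "S (Suc (Suc k)) = s * S k + t * S (Suc k)" using ij l by (simp add: S algebra_simps)
    with step.IH show ?case by simp
  qed
  define A where "A = (\<Sum>a=1..n. \<bar>real_of_int (c a)\<bar>)"
  \<comment> \<open>Orthogonality to \<open>b k\<close> leaves only the errors
    \<open>\<zeta> a * b k 0 - b k a\<close> in the product of the form at \<open>c\<close> with
    \<open>b k 0\<close>. They stay bounded while |b k 0| is unbounded, so the form vanishes at
    \<open>c\<close>.\<close>
  have bound: "\<bar>Lform n \<zeta> c\<bar> * real_of_int \<bar>b k 0\<bar> \<le> A * Sdist n \<zeta> (b 0)" if k: "k \<ge> K" for k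
  proof -
    have "S k = real_of_int (c 0) * of_int (b k 0) + (\<Sum>a=1..n. real_of_int (c a) * of_int (b k a))"
      unfolding S_def by (simp add: sum.atLeast_Suc_atMost)
    then have "Lform n \<zeta> c * of_int (b k 0)
        = (\<Sum>a=1..n. of_int (c a) * (\<zeta> a * of_int (b k 0) - of_int (b k a)))"
      using S0[OF k] by (simp add: Lform_def algebra_simps sum_subtractf sum_distrib_left)
    then have "\<bar>Lform n \<zeta> c\<bar> * real_of_int \<bar>b k 0\<bar>
        = \<bar>\<Sum>a=1..n. of_int (c a) * (\<zeta> a * of_int (b k 0) - of_int (b k a))\<bar>"
      by (simp flip: abs_mult)
    also have "\<dots> \<le> (\<Sum>a=1..n. \<bar>of_int (c a)\<bar> * Sdist n \<zeta> (b 0))"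
    proof (intro order_trans[OF sum_abs] sum_mono)
      fix a assume a: "a \<in> {1..n}"
      show "\<bar>of_int (c a) * (\<zeta> a * of_int (b k 0) - of_int (b k a))\<bar> \<le> \<bar>of_int (c a)\<bar> * Sdist n \<zeta> (b 0)"
        unfolding abs_mult
        using Sdist_ge[OF a, of \<zeta> "b k"] minimal_seq_D_le[OF b, of 0 k] by (intro mult_left_mono) auto
    qed
    finally show ?thesis by (simp add: A_def sum_distrib_right)
  qed
  have "Lform n \<zeta> c = 0"
  proof (rule ccontr)
    assume L: "Lform n \<zeta> c \<noteq> 0"
    define Z where "Z = A * Sdist n \<zeta> (b 0) / \<bar>Lform n \<zeta> c\<bar> + 1"
    have "\<forall>\<^sub>F k in sequentially. Z \<le> real_of_int \<bar>b k 0\<bar> \<and> K \<le> k"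
      using minimal_seq_h_ge[OF b, of Z] eventually_ge_at_top[of K] by (rule eventually_conj)
    then obtain k where k: "Z \<le> real_of_int \<bar>b k 0\<bar>" "K \<le> k"
      using eventually_happens'[OF trivial_limit_sequentially] by blast
    have "\<bar>Lform n \<zeta> c\<bar> * Z \<le> A * Sdist n \<zeta> (b 0)"
      using bound[OF k(2)] mult_left_mono[OF k(1), of "\<bar>Lform n \<zeta> c\<bar>"] by linarith
    moreover have "\<bar>Lform n \<zeta> c\<bar> * Z = A * Sdist n \<zeta> (b 0) + \<bar>Lform n \<zeta> c\<bar>"
      using L by (simp add: Z_def distrib_left)
    ultimately show False using L by simp
  qed
  then have "c l = 0" using Lform_eq_0D[OF indep] l by blast
  then have "M i j = 0" by (simp add: c_def)
  then show False using minor[of K] by (simp add: M_def)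
qed

section \<open>Best approximations as minimal points\<close>

text \<open>A vector u violating minimality yields a vector v of least height among those closer
  than \<open>b k\<close>. Such a v is a best approximation, so it is \<open>b j\<close> up to sign;
  its distance forces j > k, and monotone heights contradict the small height of u.\<close>

lemma best_lin_seq_minimal:
  assumes "best_seq (best_lin n \<zeta>) (\<lambda>v. \<bar>Lform n \<zeta> v\<bar>) b"
  shows "minimal_seq n (Hgt n) (\<lambda>v. \<bar>Lform n \<zeta> v\<bar>) b"
proof -
  let ?D = "\<lambda>v. \<bar>Lform n \<zeta> v\<bar>"
  have best: "best_lin n \<zeta> (b k)" and dec: "?D (b (Suc k)) < ?D (b k)"
    and all: "best_lin n \<zeta> v \<Longrightarrow> \<exists>k. v = b k \<or> v = - b k" for k v
    using assms by (auto simp: best_seq_def)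
  have v: "int_vec n (b k)" "nonzero_vec n (b k)" for k using best by (auto simp: best_lin_def)
  have Hm: "Hgt n (- u) = Hgt n u" "?D (- u) = ?D u" for u
    by (simp_all add: Hgt_def Lform_def sum_negf flip: abs_minus_commute)
  have mono: "Hgt n (b k) \<le> Hgt n (b (Suc k))" for k
    using best[of k] dec[of k] v[of "Suc k"] by (force simp: best_lin_def)
  have least: "?D (b k) \<le> ?D u" if "int_vec n u" "nonzero_vec n u" "Hgt n u < Hgt n (b (Suc k))" for k u
  proof (rule ccontr)
    define Q where "Q v \<longleftrightarrow> int_vec n v \<and> nonzero_vec n v \<and> ?D v < ?D (b k)" for v
    assume "\<not> ?thesis"
    then have "Q u" using that by (simp add: Q_def)
    then obtain v where v: "Q v" "\<And>u. Q u \<Longrightarrow> nat (Hgt n v) \<le> nat (Hgt n u)"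
      using ex_has_least_nat[of Q u "\<lambda>v. nat (Hgt n v)"] by blast
    have "best_lin n \<zeta> v"
      unfolding best_lin_def
    proof (intro conjI allI impI)
      fix u' assume u': "int_vec n u' \<and> nonzero_vec n u' \<and> Hgt n u' < Hgt n v"
      then have "\<not> Q u'" using v(2)[of u'] Hgt_nonneg[of n u'] by auto
      then show "?D v < ?D u'" using u' v(1) by (auto simp: Q_def)
    qed (use v(1) in \<open>auto simp: Q_def\<close>)
    then obtain j where j: "v = b j \<or> v = - b j" using all by blast
    then have "?D (b j) < ?D (b k)" "Hgt n v = Hgt n (b j)" using v(1) Hm by (auto simp: Q_def)
    moreover have "?D (b k) \<le> ?D (b j)" if "j \<le> k"
      using lift_Suc_mono_le[of "\<lambda>k. - ?D (b k)" j k] dec that by (simp add: less_imp_le)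
    ultimately have "Suc k \<le> j" by linarith
    then have "Hgt n (b (Suc k)) \<le> Hgt n v"
      using lift_Suc_mono_le[of "\<lambda>k. Hgt n (b k)"] mono \<open>Hgt n v = Hgt n (b j)\<close> by simp
    moreover have "Hgt n v \<le> Hgt n u" using v(2)[OF \<open>Q u\<close>] Hgt_nonneg[of n u] by simp
    ultimately show False using that by simp
  qed
  show ?thesis unfolding minimal_seq_def using v dec mono least by blast
qed

text \<open>As for the linear form, but \<open>best_sim\<close> also demands least distance up to
  the given height and \<open>v 0 \<noteq> 0\<close>. The former is met by a second minimisation,
  over a finite set, the latter by \<open>less_1\<close>.\<close>

lemma best_sim_seq_minimal:
  assumes n: "n \<ge> 1" and indep: "Q_lin_indep_1 n \<zeta>"
    and bs: "best_seq (best_sim n \<zeta>) (Sdist n \<zeta>) b"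
  shows "minimal_seq n (\<lambda>v. \<bar>v 0\<bar>) (Sdist n \<zeta>) b"
proof -
  interpret approximation n "\<lambda>v. \<bar>v 0\<bar>" "Sdist n \<zeta>"
    by (rule simultaneous_approximation[OF n indep])
  let ?D = "Sdist n \<zeta>"
  have best: "best_sim n \<zeta> (b k)" and dec: "?D (b (Suc k)) < ?D (b k)"
    and all: "best_sim n \<zeta> v \<Longrightarrow> \<exists>k. v = b k \<or> v = - b k" for k v
    using bs by (auto simp: best_seq_def)
  have v: "int_vec n (b k)" "nonzero_vec n (b k)" for k using best by (auto simp: best_sim_def nonzero_vec_def)
  have Dm: "?D (- u) = ?D u" for u
    using Sdist_homogeneous[OF n, of "- u" "- 1" u \<zeta>] by simp
  have mono: "\<bar>b k 0\<bar> \<le> \<bar>b (Suc k) 0\<bar>" for k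
    using best[of k] dec[of k] v[of "Suc k"] by (force simp: best_sim_def)
  have less_1: "?D (b k) < 1" for k
  proof -
    \<comment> \<open>A unit vector of height 0 and distance at most 1, so every best approximation
      has distance below 1. A nonzero vector with \<open>v 0 = 0\<close> has distance at least
      1.\<close>
    define e :: "nat \<Rightarrow> int" where "e i = (if i = 1 then 1 else 0)" for i
    have "int_vec n e" "nonzero_vec n e" "\<bar>e 0\<bar> < \<bar>b k 0\<bar>"
      using n best[of k] by (auto simp: int_vec_def nonzero_vec_def e_def best_sim_def)
    then have "?D (b k) < ?D e" using best[of k] by (auto simp: best_sim_def)
    also have "?D e \<le> 1" by (auto simp: Sdist_le_iff[OF n] e_def)
    finally show ?thesis .
  qed
  have least: "?D (b k) \<le> ?D u" if u: "int_vec n u" "nonzero_vec n u" "\<bar>u 0\<bar> < \<bar>b (Suc k) 0\<bar>" for k u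
  proof (rule ccontr)
    define Q where "Q v \<longleftrightarrow> int_vec n v \<and> nonzero_vec n v \<and> ?D v < ?D (b k)" for v
    assume "\<not> ?thesis"
    then have "Q u" using u by (simp add: Q_def)
    then obtain v0 where v0: "Q v0" "\<And>u. Q u \<Longrightarrow> nat \<bar>v0 0\<bar> \<le> nat \<bar>u 0\<bar>"
      using ex_has_least_nat[of Q u "\<lambda>v. nat \<bar>v 0\<bar>"] by blast
    define A where "A = {v. Q v \<and> \<bar>v 0\<bar> \<le> \<bar>v0 0\<bar>}"
    have "finite A"
      by (rule finite_subset[OF _ finite_bounded[of "\<bar>v0 0\<bar>" "?D (b k)"]]) (auto simp: A_def Q_def)
    moreover have "v0 \<in> A" using v0 by (simp add: A_def)
    ultimately obtain v where v: "v \<in> A" "\<And>u. u \<in> A \<Longrightarrow> ?D v \<le> ?D u"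
      using ex_min_if_finite[of "?D ` A"] by (metis (no_types, opaque_lifting) arg_min_if_finite(1) arg_min_least empty_iff)
    have min: "\<bar>v 0\<bar> \<le> \<bar>u' 0\<bar>" if "Q u'" for u'
      using v v0(2)[OF that] by (auto simp: A_def)
    have Qv: "Q v" using v by (simp add: A_def)
    have "best_sim n \<zeta> v"
      unfolding best_sim_def
    proof (intro conjI allI impI)
      show "v 0 \<noteq> 0"
      proof
        assume "v 0 = 0"
        moreover have "?D v < 1" using Qv less_1[of k] by (simp add: Q_def)
        ultimately have "\<bar>real_of_int (v i)\<bar> < 1" if "i \<in> {1..n}" for i
          using Sdist_ge[OF that, of \<zeta> v] by simp
        then have "\<bar>real_of_int (v i)\<bar> < 1" if "i \<le> n" for i
          using that \<open>v 0 = 0\<close> by (cases "i = 0") auto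
        then have "v i = 0" if "i \<le> n" for i
          using that by fastforce
        then show False using Qv by (auto simp: Q_def nonzero_vec_def)
      qed
    next
      fix u' assume u': "int_vec n u' \<and> nonzero_vec n u' \<and> \<bar>u' 0\<bar> < \<bar>v 0\<bar>"
      then have "\<not> Q u'" using min[of u'] by auto
      then show "?D v < ?D u'" using u' Qv by (auto simp: Q_def)
    next
      fix u' assume u': "int_vec n u' \<and> nonzero_vec n u' \<and> \<bar>u' 0\<bar> \<le> \<bar>v 0\<bar>"
      show "?D v \<le> ?D u'"
      proof (cases "Q u'")
        case True
        then have "u' \<in> A" using u' v(1) by (auto simp: A_def)
        then show ?thesis by (rule v(2))
      next
        case False
        then show ?thesis using u' Qv by (auto simp: Q_def)
      qed
    qed (use Qv in \<open>auto simp: Q_def\<close>)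
    then obtain j where j: "v = b j \<or> v = - b j" using all by blast
    then have "?D (b j) < ?D (b k)" "\<bar>v 0\<bar> = \<bar>b j 0\<bar>" using Qv Dm by (auto simp: Q_def)
    moreover have "?D (b k) \<le> ?D (b j)" if "j \<le> k"
      using lift_Suc_mono_le[of "\<lambda>k. - ?D (b k)" j k] dec that by (simp add: less_imp_le)
    ultimately have "Suc k \<le> j" by linarith
    then have "\<bar>b (Suc k) 0\<bar> \<le> \<bar>v 0\<bar>"
      using lift_Suc_mono_le[of "\<lambda>k. \<bar>b k 0\<bar>"] mono \<open>\<bar>v 0\<bar> = \<bar>b j 0\<bar>\<close> by simp
    moreover have "\<bar>v 0\<bar> \<le> \<bar>u 0\<bar>" using min[OF \<open>Q u\<close>] .
    ultimately show False using u by simp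
  qed
  show ?thesis unfolding minimal_seq_def using v dec mono least by blast
qed

section \<open>Determinant estimates\<close>

text \<open>Omitting the smaller of two factors leaves the larger product; this locates the dominant
  term of a determinant expansion.\<close>

lemma prod_remove_le:
  fixes c :: "nat \<Rightarrow> real"
  assumes "finite S" "p \<in> S" "q \<in> S" "c p \<le> c q" "\<And>i. i \<in> S \<Longrightarrow> 0 \<le> c i"
  shows "prod c (S - {q}) \<le> prod c (S - {p})"
proof (cases "p = q")
  case False
  have "prod c (S - {q}) = c p * prod c (S - {q} - {p})"
    using assms False by (intro prod.remove) auto
  also have "\<dots> \<le> c q * prod c (S - {q} - {p})"
    using assms by (intro mult_right_mono prod_nonneg) auto
  also have "S - {q} - {p} = S - {p} - {q}" by auto
  also have "c q * prod c (S - {p} - {q}) = prod c (S - {p})"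
    using assms False by (intro prod.remove[symmetric]) auto
  finally show ?thesis .
qed simp

text \<open>Each of the (n+1)! terms of the Leibniz expansion takes exactly one entry from column 0,
  in some row i, bounded by \<open>a i\<close>; the other rows contribute their
  \<open>c\<close>.\<close>

lemma det_bound:
  fixes B :: "real mat"
  assumes B: "B \<in> carrier_mat (Suc n) (Suc n)"
    and a: "\<And>i. i \<le> n \<Longrightarrow> \<bar>B $$ (i, 0)\<bar> \<le> a i"
    and c: "\<And>i j. i \<le> n \<Longrightarrow> 1 \<le> j \<Longrightarrow> j \<le> n \<Longrightarrow> \<bar>B $$ (i, j)\<bar> \<le> c i"
    and M: "\<And>i. i \<le> n \<Longrightarrow> a i * prod c ({..n} - {i}) \<le> M"
  shows "\<bar>Determinant.det B\<bar> \<le> fact (Suc n) * M"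
proof -
  let ?P = "{p. p permutes {0..<Suc n}}"
  have "\<bar>Determinant.det B\<bar> \<le> (\<Sum>p\<in>?P. \<bar>signof p * (\<Prod>i=0..<Suc n. B $$ (i, p i))\<bar>)"
    unfolding det_def'[OF B] by (rule sum_abs)
  also have "\<dots> \<le> (\<Sum>p\<in>?P. M)"
  proof (rule sum_mono)
    fix p assume "p \<in> ?P"
    then have p: "p permutes {0..<Suc n}" by simp
    have "0 \<in> p ` {0..<Suc n}" unfolding permutes_image[OF p] by simp
    then obtain i where i: "i \<in> {0..<Suc n}" "p i = 0" by (metis imageE)
    have inj: "p j \<noteq> 0" if "j \<noteq> i" for j
      using permutes_inj[OF p] i that by (metis injD)
    have S: "{0..<Suc n} = {..n}" by auto
    have le: "p j \<le> n" if "j \<le> n" for j using permutes_in_image[OF p, of j] that by simp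
    have "\<bar>signof p * (\<Prod>i=0..<Suc n. B $$ (i, p i))\<bar> = (\<Prod>i=0..<Suc n. \<bar>B $$ (i, p i)\<bar>)"
      by (simp add: abs_mult abs_prod sign_def)
    also have "\<dots> = \<bar>B $$ (i, p i)\<bar> * (\<Prod>j\<in>{0..<Suc n} - {i}. \<bar>B $$ (j, p j)\<bar>)"
      using i by (intro prod.remove) auto
    also have "\<dots> \<le> a i * prod c ({..n} - {i})"
    proof (intro mult_mono)
      show "\<bar>B $$ (i, p i)\<bar> \<le> a i" using a[of i] i by simp
      then show "0 \<le> a i" by linarith
      show "(\<Prod>j\<in>{0..<Suc n} - {i}. \<bar>B $$ (j, p j)\<bar>) \<le> prod c ({..n} - {i})"
        unfolding S
      proof (intro prod_mono conjI)
        fix j assume j: "j \<in> {..n} - {i}"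
        then show "\<bar>B $$ (j, p j)\<bar> \<le> c j" using inj[of j] le[of j] by (intro c) auto
      qed simp
    qed (simp add: prod_nonneg)
    also have "\<dots> \<le> M" using i by (intro M) auto
    finally show "\<bar>signof p * (\<Prod>i=0..<Suc n. B $$ (i, p i))\<bar> \<le> M" .
  qed
  also have "\<dots> = fact (Suc n) * M"
    by (simp add: card_permutations[of _ "Suc n"] del: fact_Suc)
  finally show ?thesis .
qed

text \<open>The determinant is an integer, so it suffices that it is nonzero: a kernel vector of the
  transpose would be a linear relation among the rows \<open>V i\<close>.\<close>

lemma lin_indep_det_ge_1:
  assumes "lin_indep n (Suc n) V"
  shows "1 \<le> \<bar>Determinant.det (mat (Suc n) (Suc n) (\<lambda>(i, j). real_of_int (V i j)))\<bar>"
proof -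
  define N where "N = Suc n"
  define Z where "Z = mat N N (\<lambda>(i, j). V i j)"
  define A where "A = mat N N (\<lambda>(i, j). real_of_int (V i j))"
  have A: "A \<in> carrier_mat N N" by (simp add: A_def)
  have "A = map_mat real_of_int Z" by (auto simp: A_def Z_def)
  then have det: "Determinant.det A = of_int (Determinant.det Z)" by simp
  have "Determinant.det A \<noteq> 0"
  proof
    assume "Determinant.det A = 0"
    then have "Determinant.det (transpose_mat A) = 0" using det_transpose[OF A] by simp
    then obtain v where v: "v \<in> carrier_vec N" "v \<noteq> 0\<^sub>v N" "transpose_mat A *\<^sub>v v = 0\<^sub>v N"
      using det_0_iff_vec_prod_zero[of "transpose_mat A" N] A by auto
    have "(\<Sum>k<Suc n. vec_index v k * real_of_int (V k i)) = 0" if "i \<le> n" for i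
    proof -
      have "vec_index (transpose_mat A *\<^sub>v v) i = 0" using v(3) that by (simp add: N_def)
      then show ?thesis
        using that v(1) by (simp add: A_def N_def scalar_prod_def atLeast0LessThan mult.commute)
    qed
    then have "\<forall>k<Suc n. vec_index v k = 0" using assms unfolding lin_indep_def by blast
    then have "v = 0\<^sub>v N" using v(1) by (intro eq_vecI) (auto simp: N_def)
    with v(2) show False by simp
  qed
  then have "Determinant.det Z \<noteq> 0" using det by auto
  then show ?thesis using det unfolding A_def N_def by linarith
qed

text \<open>The matrix \<open>T\<close> has determinant 1 and replaces column 0 by the values of the
  form. Row 0 has the largest value and the smallest height, so the bound is largest when column 0
  contributes its entry from that row.\<close>

lemma linear_form_det_bound:
  assumes V: "lin_indep n (Suc n) V"
    and L: "\<And>i. i \<le> n \<Longrightarrow> \<bar>Lform n \<zeta> (V i)\<bar> \<le> \<bar>Lform n \<zeta> (V 0)\<bar>"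
    and H: "\<And>i. i \<le> n \<Longrightarrow> Hgt n (V 0) \<le> Hgt n (V i)"
  shows "1 \<le> fact (Suc n) * (\<bar>Lform n \<zeta> (V 0)\<bar> * (\<Prod>j<n. real_of_int (Hgt n (V (Suc j)))))"
proof -
  define N where "N = Suc n"
  define A where "A = mat N N (\<lambda>(i, j). real_of_int (V i j))"
  define T where "T = mat N N (\<lambda>(i, j). if j = 0 then (if i = 0 then 1 else \<zeta> i) else if i = j then 1 else 0)"
  have carrier: "A \<in> carrier_mat N N" "T \<in> carrier_mat N N" by (auto simp: A_def T_def)
  have "Determinant.det T = prod_list (diag_mat T)"
    by (rule det_lower_triangular[OF _ carrier(2)]) (auto simp: T_def)
  also have "\<dots> = 1" unfolding prod_list_diag_prod by (rule prod.neutral) (auto simp: T_def)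
  finally have det: "Determinant.det (A * T) = Determinant.det A"
    using det_mult[OF carrier] by simp
  have entry: "(A * T) $$ (i, j) = (\<Sum>k\<le>n. real_of_int (V i k) * T $$ (k, j))" if "i \<le> n" "j \<le> n" for i j
    using that by (simp add: A_def T_def N_def scalar_prod_def lessThan_Suc_atMost atLeast0LessThan
        del: sum.lessThan_Suc)
  have "\<bar>Determinant.det (A * T)\<bar> \<le> fact (Suc n) * (\<bar>Lform n \<zeta> (V 0)\<bar> * prod (\<lambda>i. real_of_int (Hgt n (V i))) ({..n} - {0}))"
  proof (rule det_bound)
    show "A * T \<in> carrier_mat (Suc n) (Suc n)" using carrier by (simp add: N_def)
    fix i assume i: "i \<le> n"
    have "(A * T) $$ (i, 0) = (\<Sum>k=0..n. real_of_int (V i k) * (if k = 0 then 1 else \<zeta> k))"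
      unfolding entry[OF i le0] by (intro sum.cong) (auto simp: T_def N_def)
    also have "\<dots> = Lform n \<zeta> (V i)"
      by (subst sum.atLeast_Suc_atMost) (auto simp: Lform_def mult.commute intro!: sum.cong)
    finally show "\<bar>(A * T) $$ (i, 0)\<bar> \<le> \<bar>Lform n \<zeta> (V i)\<bar>" by simp
    show "\<bar>(A * T) $$ (i, j)\<bar> \<le> real_of_int (Hgt n (V i))" if "1 \<le> j" "j \<le> n" for j
    proof -
      have "(A * T) $$ (i, j) = (\<Sum>k\<le>n. if k = j then real_of_int (V i k) else 0)"
        unfolding entry[OF i that(2)] using that by (intro sum.cong) (auto simp: T_def N_def)
      also have "\<dots> = of_int (V i j)" using that by simp
      finally show ?thesis using Hgt_ge[OF that(2), of "V i"] by simp
    qed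
    show "\<bar>Lform n \<zeta> (V i)\<bar> * prod (\<lambda>i. real_of_int (Hgt n (V i))) ({..n} - {i})
        \<le> \<bar>Lform n \<zeta> (V 0)\<bar> * prod (\<lambda>i. real_of_int (Hgt n (V i))) ({..n} - {0})"
      using i L H Hgt_nonneg by (intro mult_mono prod_remove_le prod_nonneg) auto
  qed
  moreover have "{..n} - {0} = Suc ` {..<n}" unfolding image_Suc_lessThan by auto
  moreover have "1 \<le> \<bar>Determinant.det A\<bar>" using lin_indep_det_ge_1[OF V] by (simp add: A_def N_def)
  ultimately show ?thesis using det by (simp add: prod.reindex del: fact_Suc)
qed

text \<open>Here \<open>T\<close>, of determinant 1 or -1, keeps column 0 and turns column j into
  the error of the j-th coordinate. The last row has the largest |x| and the smallest distance, so
  it dominates.\<close>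

lemma simultaneous_det_bound:
  assumes n: "n \<ge> 1" and V: "lin_indep n (Suc n) V"
    and D: "\<And>i. i \<le> n \<Longrightarrow> Sdist n \<zeta> (V n) \<le> Sdist n \<zeta> (V i)"
    and H: "\<And>i. i \<le> n \<Longrightarrow> \<bar>V i 0\<bar> \<le> \<bar>V n 0\<bar>"
  shows "1 \<le> fact (Suc n) * (real_of_int \<bar>V n 0\<bar> * (\<Prod>j<n. Sdist n \<zeta> (V j)))"
proof -
  define N where "N = Suc n"
  define A where "A = mat N N (\<lambda>(i, j). real_of_int (V i j))"
  define T where "T = mat N N (\<lambda>(i, j). if i = 0 then (if j = 0 then 1 else \<zeta> j) else if i = j then - 1 else 0)"
  have carrier: "A \<in> carrier_mat N N" "T \<in> carrier_mat N N" by (auto simp: A_def T_def)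
  have "Determinant.det T = prod_list (diag_mat T)"
    by (rule det_upper_triangular[OF _ carrier(2)]) (auto simp: T_def upper_triangular_def)
  then have "\<bar>Determinant.det T\<bar> = (\<Prod>i=0..<dim_row T. \<bar>T $$ (i, i)\<bar>)"
    by (simp add: prod_list_diag_prod abs_prod)
  also have "\<dots> = 1" by (rule prod.neutral) (auto simp: T_def)
  finally have det: "\<bar>Determinant.det (A * T)\<bar> = \<bar>Determinant.det A\<bar>"
    using det_mult[OF carrier] by (simp add: abs_mult)
  have entry: "(A * T) $$ (i, j) = (\<Sum>k\<le>n. real_of_int (V i k) * T $$ (k, j))" if "i \<le> n" "j \<le> n" for i j
    using that by (simp add: A_def T_def N_def scalar_prod_def lessThan_Suc_atMost atLeast0LessThan
        del: sum.lessThan_Suc)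
  have "\<bar>Determinant.det (A * T)\<bar> \<le> fact (Suc n) * (real_of_int \<bar>V n 0\<bar> * prod (\<lambda>i. Sdist n \<zeta> (V i)) ({..n} - {n}))"
  proof (rule det_bound)
    show "A * T \<in> carrier_mat (Suc n) (Suc n)" using carrier by (simp add: N_def)
    fix i assume i: "i \<le> n"
    have "(A * T) $$ (i, 0) = (\<Sum>k\<le>n. if k = 0 then real_of_int (V i k) else 0)"
      unfolding entry[OF i le0] by (intro sum.cong) (auto simp: T_def N_def)
    then show "\<bar>(A * T) $$ (i, 0)\<bar> \<le> real_of_int \<bar>V i 0\<bar>" by simp
    show "\<bar>(A * T) $$ (i, j)\<bar> \<le> Sdist n \<zeta> (V i)" if "1 \<le> j" "j \<le> n" for j
    proof -
      have "(A * T) $$ (i, j) = (\<Sum>k\<le>n. (if k = 0 then \<zeta> j * real_of_int (V i k) else 0)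
          + (if k = j then - real_of_int (V i k) else 0))"
        unfolding entry[OF i that(2)] using that by (intro sum.cong) (auto simp: T_def N_def)
      also have "\<dots> = \<zeta> j * of_int (V i 0) - of_int (V i j)" using that by (simp add: sum.distrib)
      finally show ?thesis using Sdist_ge[of j n \<zeta> "V i"] that by simp
    qed
    show "real_of_int \<bar>V i 0\<bar> * prod (\<lambda>i. Sdist n \<zeta> (V i)) ({..n} - {i})
        \<le> real_of_int \<bar>V n 0\<bar> * prod (\<lambda>i. Sdist n \<zeta> (V i)) ({..n} - {n})"
      using i D H Sdist_nonneg[OF n] by (intro mult_mono prod_remove_le prod_nonneg) (auto simp flip: of_int_abs)
  qed
  moreover have "{..n} - {n} = {..<n}" by auto
  moreover have "1 \<le> \<bar>Determinant.det A\<bar>" using lin_indep_det_ge_1[OF V] by (simp add: A_def N_def)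
  ultimately show ?thesis using det by (simp del: fact_Suc)
qed

section \<open>Transfer to the exponents of the two settings\<close>

lemma w_exp_eq: "w_exp n j \<zeta> = approx_exp n (Hgt n) (\<lambda>v. \<bar>Lform n \<zeta> v\<bar>) j"
  and w_hat_exp_eq: "w_hat_exp n j \<zeta> = approx_hat_exp n (Hgt n) (\<lambda>v. \<bar>Lform n \<zeta> v\<bar>) j"
  by (simp_all add: w_exp_def w_hat_exp_def approx_exp_def approx_hat_exp_def lin_sys_def approx_sys_def)

lemma lambda_exp_eq: "lambda_exp n j \<zeta> = approx_exp n (\<lambda>v. \<bar>v 0\<bar>) (Sdist n \<zeta>) j"
  and lambda_hat_exp_eq: "lambda_hat_exp n j \<zeta> = approx_hat_exp n (\<lambda>v. \<bar>v 0\<bar>) (Sdist n \<zeta>) j"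
  by (simp_all add: lambda_exp_def lambda_hat_exp_def approx_exp_def approx_hat_exp_def sim_sys_def approx_sys_def)

text \<open>An infinite \<open>w_exp\<close> makes the claim trivial, so both exponents may be taken
  finite. The determinant estimate for n + 1 consecutive points then feeds
  \<open>approx_hat_le_power_sum\<close>, and the uniform exponent, being at least 3/2, exceeds
  1.\<close>

lemma linear_form_exp_lower_bound:
  assumes n: "n \<ge> 2" and indep: "Q_lin_indep_1 n \<zeta>"
    and b: "minimal_seq n (Hgt n) (\<lambda>v. \<bar>Lform n \<zeta> v\<bar>) b"
    and inf: "infinite {k. lin_indep n (n + 1) (\<lambda>i. b (k + i))}"
  shows "w_exp n 1 \<zeta> \<ge>
          (if w_hat_exp n 1 \<zeta> = \<infinity> then \<infinity>
           else ereal (real_of_ereal (w_hat_exp n 1 \<zeta>) *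
                 ((real_of_ereal (w_hat_exp n 1 \<zeta>) - 1) / (real n - 1)) powr (1 / (real n - 1))))"
proof -
  interpret approximation n "Hgt n" "\<lambda>v. \<bar>Lform n \<zeta> v\<bar>"
    by (rule linear_form_approximation[OF n indep])
  have le: "w_hat_exp n 1 \<zeta> \<le> w_exp n 1 \<zeta>" unfolding w_exp_eq w_hat_exp_eq by (rule approx_hat_le_exp)
  have ge: "ereal (3/2) \<le> w_hat_exp n 1 \<zeta>" unfolding w_hat_exp_eq by (rule linear_form_hat_ge[OF n])
  show ?thesis
  proof (cases "w_exp n 1 \<zeta> = \<infinity>")
    case False
    then obtain wh where wh: "w_hat_exp n 1 \<zeta> = ereal wh" "3/2 \<le> wh"
      using le ge by (cases "w_hat_exp n 1 \<zeta>") auto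
    then obtain w where w: "w_exp n 1 \<zeta> = ereal w" "wh \<le> w"
      using le False by (cases "w_exp n 1 \<zeta>") auto
    have "wh \<le> (\<Sum>j<n. (w / wh) ^ j)"
    proof (rule approx_hat_le_power_sum[OF b inf])
      fix k assume "lin_indep n (n + 1) (\<lambda>i. b (k + i))"
      then have "1 \<le> fact (Suc n) * (\<bar>Lform n \<zeta> (b (k + 0))\<bar> * (\<Prod>j<n. real_of_int (Hgt n (b (k + Suc j)))))"
        using minimal_seq_D_le[OF b] minimal_seq_h_le[OF b] by (intro linear_form_det_bound) auto
      then show "1 \<le> fact (Suc n) * \<bar>Lform n \<zeta> (b k)\<bar> * (\<Prod>j<n. real_of_int (Hgt n (b (Suc k + j))))"
        by (simp add: mult.assoc del: fact_Suc)
    qed (use wh w in \<open>auto simp: w_exp_eq w_hat_exp_eq\<close>)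
    then show ?thesis using power_sum_lower_bound[OF n] wh w by simp
  qed simp
qed

lemma simultaneous_exp_lower_bound:
  assumes n: "n \<ge> 2" and indep: "Q_lin_indep_1 n \<zeta>"
    and b: "minimal_seq n (\<lambda>v. \<bar>v 0\<bar>) (Sdist n \<zeta>) b"
    and inf: "infinite {k. lin_indep n (n + 1) (\<lambda>i. b (k + i))}"
  shows "lambda_exp n 1 \<zeta> \<ge>
          (if lambda_hat_exp n 1 \<zeta> \<ge> 1 then \<infinity>
           else ereal (real_of_ereal (lambda_hat_exp n 1 \<zeta>) *
                 ((real n - 1) * real_of_ereal (lambda_hat_exp n 1 \<zeta>)
                   / (1 - real_of_ereal (lambda_hat_exp n 1 \<zeta>))) powr (1 / (real n - 1))))"
proof -
  have n1: "n \<ge> 1" using n by simp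
  interpret approximation n "\<lambda>v. \<bar>v 0\<bar>" "Sdist n \<zeta>"
    by (rule simultaneous_approximation[OF n1 indep])
  have le: "lambda_hat_exp n 1 \<zeta> \<le> lambda_exp n 1 \<zeta>"
    unfolding lambda_exp_eq lambda_hat_exp_eq by (rule approx_hat_le_exp)
  have pos: "0 < lambda_hat_exp n 1 \<zeta>" unfolding lambda_hat_exp_eq by (rule approx_hat_pos)
  show ?thesis
  proof (cases "lambda_exp n 1 \<zeta> = \<infinity>")
    case False
    then obtain wh where wh: "lambda_hat_exp n 1 \<zeta> = ereal wh" "0 < wh"
      using le pos by (cases "lambda_hat_exp n 1 \<zeta>") auto
    then obtain w where w: "lambda_exp n 1 \<zeta> = ereal w" "wh \<le> w"
      using le False by (cases "lambda_exp n 1 \<zeta>") auto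
    have sum: "wh * (\<Sum>j<n. (wh / w) ^ j) \<le> 1"
    proof (rule approx_hat_mult_power_sum_le[OF b inf])
      fix k assume "lin_indep n (n + 1) (\<lambda>i. b (k + i))"
      then have "1 \<le> fact (Suc n) * (real_of_int \<bar>b (k + n) 0\<bar> * (\<Prod>j<n. Sdist n \<zeta> (b (k + j))))"
        using minimal_seq_D_le[OF b] minimal_seq_h_le[OF b] by (intro simultaneous_det_bound[OF n1]) auto
      then show "1 \<le> fact (Suc n) * real_of_int \<bar>b (k + n) 0\<bar> * (\<Prod>j<n. Sdist n \<zeta> (b (k + j)))"
        by (simp add: mult.assoc del: fact_Suc)
    qed (use wh w in \<open>auto simp: lambda_exp_eq lambda_hat_exp_eq\<close>)
    \<comment> \<open>For n at least 2 the geometric sum strictly exceeds its first term 1. Hence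
      here a uniform exponent of 1 or more occurs only together with an infinite ordinary exponent,
      as the first branch of the conditional states.\<close>
    have "wh < 1"
    proof -
      obtain m where m: "n = Suc (Suc m)" using n by (metis Suc_le_D numeral_2_eq_2 Suc_le_mono)
      have "0 < (\<Sum>j<Suc m. (wh / w) ^ Suc j)"
        using wh w by (intro sum_pos zero_less_power divide_pos_pos) auto
      then have "1 < (\<Sum>j<n. (wh / w) ^ j)"
        unfolding m by (subst sum.lessThan_Suc_shift) (simp only: power_0 less_add_same_cancel1)
      then have "wh * 1 < wh * (\<Sum>j<n. (wh / w) ^ j)" using wh by (intro mult_strict_left_mono)
      then show ?thesis using sum by simp
    qed
    then show ?thesis using mult_power_sum_lower_bound[OF n wh(2) _ w(2) sum] wh w by simp
  qed simp
qed

text \<open>At i = 1 the quotient means the ordinary exponent itself; this case is written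
  separately because i - 2 is truncated to 0 on natural numbers. The infinite branches interpret the
  closed formulas when the uniform exponent is infinite, respectively when 1 minus it is not
  positive.\<close>

theorem theorem4p1:
  fixes n :: nat and \<zeta> :: "nat \<Rightarrow> real"
  assumes n2: "n \<ge> 2"
    and indep: "Q_lin_indep_1 n \<zeta>"
  shows
    \<comment> \<open>(i)\<close>
    "w_exp n 3 \<zeta> \<ge> (w_hat_exp n 1 \<zeta>)^2 / w_exp n 1 \<zeta>
  \<and>
    \<comment> \<open>(ii)\<close>
    ((\<exists>b. best_seq (best_lin n \<zeta>) (\<lambda>v. \<bar>Lform n \<zeta> v\<bar>) b \<and>
          infinite {k. lin_indep n (n+1) (\<lambda>i. b (k+i))}) \<longrightarrow>
       (\<forall>i\<in>{1..n+1}. w_exp n i \<zeta> \<ge>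
          (if i = 1 then w_exp n 1 \<zeta>
           else (w_hat_exp n 1 \<zeta>)^(i-1) / (w_exp n 1 \<zeta>)^(i-2)))
       \<and> w_exp n 1 \<zeta> \<ge>
          (if w_hat_exp n 1 \<zeta> = \<infinity> then \<infinity>
           else ereal (real_of_ereal (w_hat_exp n 1 \<zeta>) *
                 ((real_of_ereal (w_hat_exp n 1 \<zeta>) - 1) / (real n - 1)) powr (1 / (real n - 1)))))
  \<and>
    \<comment> \<open>(iii)\<close>
    lambda_exp n 3 \<zeta> \<ge> (lambda_hat_exp n 1 \<zeta>)^2 / lambda_exp n 1 \<zeta>
  \<and>
    \<comment> \<open>(iv)\<close>
    ((\<exists>u. best_seq (best_sim n \<zeta>) (Sdist n \<zeta>) u \<and>
          infinite {k. lin_indep n (n+1) (\<lambda>i. u (k+i))}) \<longrightarrow>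
       (\<forall>i\<in>{1..n+1}. lambda_exp n i \<zeta> \<ge>
          (if i = 1 then lambda_exp n 1 \<zeta>
           else (lambda_hat_exp n 1 \<zeta>)^(i-1) / (lambda_exp n 1 \<zeta>)^(i-2)))
       \<and> lambda_exp n 1 \<zeta> \<ge>
          (if lambda_hat_exp n 1 \<zeta> \<ge> 1 then \<infinity>
           else ereal (real_of_ereal (lambda_hat_exp n 1 \<zeta>) *
                 ((real n - 1) * real_of_ereal (lambda_hat_exp n 1 \<zeta>)
                   / (1 - real_of_ereal (lambda_hat_exp n 1 \<zeta>))) powr (1 / (real n - 1)))))"
proof -
  have n1: "n \<ge> 1" using n2 by simp
  interpret lin: approximation n "Hgt n" "\<lambda>v. \<bar>Lform n \<zeta> v\<bar>"
    by (rule linear_form_approximation[OF n2 indep])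
  interpret sim: approximation n "\<lambda>v. \<bar>v 0\<bar>" "Sdist n \<zeta>"
    by (rule simultaneous_approximation[OF n1 indep])
  have prefix: "infinite {k. lin_indep n i (\<lambda>j. b (k + j))}"
    if "infinite {k. lin_indep n (n+1) (\<lambda>j. b (k + j))}" "i \<le> n + 1" for b i
    using that by (elim infinite_super[rotated]) (auto intro: lin_indep_prefix)
  \<comment> \<open>Parts (i) and (iii) run on constructed minimal sequences; (ii) and (iv) use the
    given best approximations, which are minimal sequences as well.\<close>
  obtain b where b: "minimal_seq n (Hgt n) (\<lambda>v. \<bar>Lform n \<zeta> v\<bar>) b"
    using lin.minimal_seq_exists by blast
  have 1: "w_exp n 3 \<zeta> \<ge> (w_hat_exp n 1 \<zeta>)^2 / w_exp n 1 \<zeta>"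
    using lin.approx_exp_ge[OF b linear_form_three_independent[OF n2 indep b]] n2
    by (simp add: w_exp_eq w_hat_exp_eq)
  obtain u where u: "minimal_seq n (\<lambda>v. \<bar>v 0\<bar>) (Sdist n \<zeta>) u"
    using sim.minimal_seq_exists by blast
  have 3: "lambda_exp n 3 \<zeta> \<ge> (lambda_hat_exp n 1 \<zeta>)^2 / lambda_exp n 1 \<zeta>"
    using sim.approx_exp_ge[OF u simultaneous_three_independent[OF n2 indep u]] n2
    by (simp add: lambda_exp_eq lambda_hat_exp_eq)
  have 2: "w_exp n i \<zeta> \<ge> (if i = 1 then w_exp n 1 \<zeta>
           else (w_hat_exp n 1 \<zeta>)^(i-1) / (w_exp n 1 \<zeta>)^(i-2))"
    if "best_seq (best_lin n \<zeta>) (\<lambda>v. \<bar>Lform n \<zeta> v\<bar>) b"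
      "infinite {k. lin_indep n (n+1) (\<lambda>i. b (k+i))}" "i \<in> {1..n+1}" for b i
    using lin.approx_exp_ge[OF best_lin_seq_minimal[OF that(1)] prefix[OF that(2), of i]] that(3)
    by (auto simp: w_exp_eq w_hat_exp_eq)
  have 4: "lambda_exp n i \<zeta> \<ge> (if i = 1 then lambda_exp n 1 \<zeta>
           else (lambda_hat_exp n 1 \<zeta>)^(i-1) / (lambda_exp n 1 \<zeta>)^(i-2))"
    if "best_seq (best_sim n \<zeta>) (Sdist n \<zeta>) b"
      "infinite {k. lin_indep n (n+1) (\<lambda>i. b (k+i))}" "i \<in> {1..n+1}" for b i
    using sim.approx_exp_ge[OF best_sim_seq_minimal[OF n1 indep that(1)] prefix[OF that(2), of i]] that(3)
    by (auto simp: lambda_exp_eq lambda_hat_exp_eq)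
  show ?thesis
    using 1 2 3 4 linear_form_exp_lower_bound[OF n2 indep best_lin_seq_minimal]
      simultaneous_exp_lower_bound[OF n2 indep best_sim_seq_minimal[OF n1 indep]]
    by (intro conjI impI ballI; (elim exE conjE)?; assumption?) blast+
qed

end
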